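(* Let $(X,b,m)$ be a connected weighted graph satisfying conditions (B) and (M), let $D\subset X$ be relatively dense and $\Omega:=X\setminus D\ne\emptyset$. Let $I\subset\mathbb{R}$ be a Borel set having a maximum with $\max I<\lambda_\Omega$. Then $$P_I(H)\,1_D\,P_I(H)\ge\frac{(\lambda_\Omega-\max I)^2}{16\,\|H+1\|^2(\lambda_\Omega+1)^2}\,P_I(H).$$
   Context: A weighted graph $(X,b,m)$: $X$ countable, $b:X\times X\to[0,\infty)$ symmetric with $b(x,x)=0$ and $\sum_y b(x,y)<\infty$, $m:X\to(0,\infty)$. Condition (B): $\sup_x\frac{1}{m(x)}\sum_y b(x,y)<\infty$. Condition (M): $\sup_x m(x)<\infty$. On $\ell^2(X,m)$ let $\mathcal{E}(f,g)=\frac12\sum_{x,y}b(x,y)(f(x)-f(y))(\overline{g(x)}-\overline{g(y)})$ and let $H$ be the associated bounded selfadjoint operator $(Hf)(x)=\frac{1}{m(x)}\sum_y b(x,y)(f(x)-f(y))$. $P_I(H)$ denotes the spectral projection of $H$ onto $I$, and $1_D$ the operator of multiplication by the indicator function of $D$. A path is $\gamma=(x_0,\dots,x_k)$ with $b(x_j,x_{j+1})>0$, of length $\sum_{j=0}^{k-1}1/b(x_j,x_{j+1})$; connected means any two points are joined by a path; $d(x,y)$ is the infimum of path lengths; $B_r(x):=\{y:d(x,y)\le r\}$. $D$ is relatively dense if $\inf\{R>0:\bigcup_{p\in D}B_R(p)=X\}<\infty$. Identify $\ell^2(\Omega,m)$ with $\{f\in\ell^2(X,m):f=0\text{ on }D\}$;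 $H_\Omega$ is the selfadjoint operator on $\ell^2(\Omega,m)$ associated with the restriction of $\mathcal{E}$ to this space, and $\lambda_\Omega:=\min\sigma(H_\Omega)$. *)

theory Defs
  imports "HOL-Analysis.Analysis"
begin

definition weighted_graph :: "('x \<Rightarrow> 'x \<Rightarrow> real) \<Rightarrow> ('x \<Rightarrow> real) \<Rightarrow> bool" where
  "weighted_graph b m \<longleftrightarrow>
     (\<forall>x y. b x y \<ge> 0) \<and> (\<forall>x y. b x y = b y x) \<and> (\<forall>x. b x x = 0) \<and>
     (\<forall>x. (\<lambda>y. b x y) summable_on UNIV) \<and> (\<forall>x. m x > 0)"

definition cond_B :: "('x \<Rightarrow> 'x \<Rightarrow> real) \<Rightarrow> ('x \<Rightarrow> real) \<Rightarrow> bool" where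
  "cond_B b m \<longleftrightarrow> (\<exists>C. \<forall>x. (\<Sum>\<^sub>\<infinity>y. b x y) / m x \<le> C)"

definition cond_M :: "('x \<Rightarrow> real) \<Rightarrow> bool" where
  "cond_M m \<longleftrightarrow> (\<exists>C. \<forall>x. m x \<le> C)"

definition gpaths :: "('x \<Rightarrow> 'x \<Rightarrow> real) \<Rightarrow> 'x \<Rightarrow> 'x \<Rightarrow> 'x list set" where
  "gpaths b x y = {xs. xs \<noteq> [] \<and> hd xs = x \<and> last xs = y \<and>
       (\<forall>i. Suc i < length xs \<longrightarrow> b (xs ! i) (xs ! Suc i) > 0)}"

definition path_length :: "('x \<Rightarrow> 'x \<Rightarrow> real) \<Rightarrow> 'x list \<Rightarrow> real" where
  "path_length b xs = (\<Sum>i<length xs - 1. 1 / b (xs ! i) (xs ! Suc i))"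

definition connected_graph :: "('x \<Rightarrow> 'x \<Rightarrow> real) \<Rightarrow> bool" where
  "connected_graph b \<longleftrightarrow> (\<forall>x y. gpaths b x y \<noteq> {})"

definition gdist :: "('x \<Rightarrow> 'x \<Rightarrow> real) \<Rightarrow> 'x \<Rightarrow> 'x \<Rightarrow> real" where
  "gdist b x y = Inf (path_length b ` gpaths b x y)"

definition gball :: "('x \<Rightarrow> 'x \<Rightarrow> real) \<Rightarrow> 'x \<Rightarrow> real \<Rightarrow> 'x set" where
  "gball b x r = {y. gdist b x y \<le> r}"

text \<open>Relatively dense: the infimum of admissible radii is finite, i.e. some radius is admissible.\<close>
definition rel_dense :: "('x \<Rightarrow> 'x \<Rightarrow> real) \<Rightarrow> 'x set \<Rightarrow> bool" where
  "rel_dense b D \<longleftrightarrow> (\<exists>R>0. (\<Union>p\<in>D. gball b p R) = UNIV)"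

definition L2 :: "('x \<Rightarrow> real) \<Rightarrow> ('x \<Rightarrow> complex) set" where
  "L2 m = {f. (\<lambda>x. (cmod (f x))\<^sup>2 * m x) summable_on UNIV}"

definition ip :: "('x \<Rightarrow> real) \<Rightarrow> ('x \<Rightarrow> complex) \<Rightarrow> ('x \<Rightarrow> complex) \<Rightarrow> complex" where
  "ip m f g = (\<Sum>\<^sub>\<infinity>x. f x * cnj (g x) * complex_of_real (m x))"

definition l2norm :: "('x \<Rightarrow> real) \<Rightarrow> ('x \<Rightarrow> complex) \<Rightarrow> real" where
  "l2norm m f = sqrt (Re (ip m f f))"

definition opnorm :: "('x \<Rightarrow> real) \<Rightarrow> (('x \<Rightarrow> complex) \<Rightarrow> ('x \<Rightarrow> complex)) \<Rightarrow> real" where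
  "opnorm m A = Sup {l2norm m (A f) | f. f \<in> L2 m \<and> l2norm m f \<le> 1}"

definition Hop :: "('x \<Rightarrow> 'x \<Rightarrow> real) \<Rightarrow> ('x \<Rightarrow> real) \<Rightarrow> ('x \<Rightarrow> complex) \<Rightarrow> ('x \<Rightarrow> complex)" where
  "Hop b m f x = complex_of_real (1 / m x) * (\<Sum>\<^sub>\<infinity>y. complex_of_real (b x y) * (f x - f y))"

definition qform :: "('x \<Rightarrow> 'x \<Rightarrow> real) \<Rightarrow> ('x \<Rightarrow> complex) \<Rightarrow> ('x \<Rightarrow> complex) \<Rightarrow> complex" where
  "qform b f g = (1/2) * (\<Sum>\<^sub>\<infinity>(x,y). complex_of_real (b x y) * (f x - f y) * cnj (g x - g y))"

definition assoc_op :: "('x \<Rightarrow> real) \<Rightarrow> ('x \<Rightarrow> complex) set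
     \<Rightarrow> (('x \<Rightarrow> complex) \<Rightarrow> ('x \<Rightarrow> complex) \<Rightarrow> complex) \<Rightarrow> ('x \<Rightarrow> complex) \<Rightarrow> ('x \<Rightarrow> complex)" where
  "assoc_op m V q = (THE A. (\<forall>f. f \<notin> V \<longrightarrow> A f = (\<lambda>_. 0)) \<and> (\<forall>f\<in>V. A f \<in> V) \<and>
                          (\<forall>f\<in>V. \<forall>g\<in>V. q f g = ip m (A f) g))"

definition spectrum_on :: "('x \<Rightarrow> real) \<Rightarrow> ('x \<Rightarrow> complex) set
     \<Rightarrow> (('x \<Rightarrow> complex) \<Rightarrow> ('x \<Rightarrow> complex)) \<Rightarrow> complex set" where
  "spectrum_on m V A = {z. \<not> (\<exists>B. (\<forall>f\<in>V. B f \<in> V) \<and>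
        (\<exists>C. \<forall>f\<in>V. l2norm m (B f) \<le> C * l2norm m f) \<and>
        (\<forall>f\<in>V. B (\<lambda>x. A f x - z * f x) = f) \<and>
        (\<forall>f\<in>V. (\<lambda>x. A (B f) x - z * B f x) = f))}"

text \<open>\<open>\<ell>\<^sup>2(\<Omega>,m)\<close> identified with functions in \<open>\<ell>\<^sup>2(X,m)\<close> vanishing on \<open>D\<close>.\<close>
definition L2_Omega :: "('x \<Rightarrow> real) \<Rightarrow> 'x set \<Rightarrow> ('x \<Rightarrow> complex) set" where
  "L2_Omega m D = {f \<in> L2 m. \<forall>x\<in>D. f x = 0}"

definition H_Omega :: "('x \<Rightarrow> 'x \<Rightarrow> real) \<Rightarrow> ('x \<Rightarrow> real) \<Rightarrow> 'x set \<Rightarrow> ('x \<Rightarrow> complex) \<Rightarrow> ('x \<Rightarrow> complex)" where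
  "H_Omega b m D = assoc_op m (L2_Omega m D) (qform b)"

definition lambda_Omega :: "('x \<Rightarrow> 'x \<Rightarrow> real) \<Rightarrow> ('x \<Rightarrow> real) \<Rightarrow> 'x set \<Rightarrow> real" where
  "lambda_Omega b m D = Inf {t. complex_of_real t \<in> spectrum_on m (L2_Omega m D) (H_Omega b m D)}"

text \<open>\<open>E\<close> is the spectral (projection-valued) measure of the selfadjoint operator \<open>A\<close>
  on \<open>\<ell>\<^sup>2(X,m)\<close>: orthogonal projections \<open>E S\<close> for Borel \<open>S\<close>, multiplicative, \<open>E \<real> = 1\<close>,
  \<open>S \<mapsto> \<langle>E S f, f\<rangle>\<close> a (countably additive) finite Borel measure, and \<open>A = \<integral> t dE(t)\<close>.
  By the spectral theorem such an \<open>E\<close> exists and is unique; \<open>P\<^sub>I(A) = E I\<close>.\<close>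
definition is_spectral_measure :: "('x \<Rightarrow> real) \<Rightarrow> (('x \<Rightarrow> complex) \<Rightarrow> ('x \<Rightarrow> complex))
     \<Rightarrow> (real set \<Rightarrow> ('x \<Rightarrow> complex) \<Rightarrow> ('x \<Rightarrow> complex)) \<Rightarrow> bool" where
  "is_spectral_measure m A E \<longleftrightarrow>
     (\<forall>S\<in>sets (borel :: real measure).
        (\<forall>f\<in>L2 m. E S f \<in> L2 m) \<and>
        (\<forall>f\<in>L2 m. \<forall>g\<in>L2 m. \<forall>c. E S (\<lambda>x. c * f x + g x) = (\<lambda>x. c * E S f x + E S g x)) \<and>
        (\<forall>f\<in>L2 m. \<forall>g\<in>L2 m. ip m (E S f) g = ip m f (E S g))) \<and>
     (\<forall>S\<in>sets (borel :: real measure). \<forall>T\<in>sets (borel :: real measure).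
        \<forall>f\<in>L2 m. E (S \<inter> T) f = E S (E T f)) \<and>
     (\<forall>f\<in>L2 m. E UNIV f = f) \<and>
     (\<forall>f\<in>L2 m. \<exists>\<mu>. finite_measure \<mu> \<and> sets \<mu> = sets (borel :: real measure) \<and>
        (\<forall>S\<in>sets (borel :: real measure). measure \<mu> S = Re (ip m (E S f) f)) \<and>
        integrable \<mu> (\<lambda>t. t) \<and> ip m (A f) f = complex_of_real (\<integral>t. t \<partial>\<mu>))"

end

theory Submission
  imports Defs
begin

text \<open>
  Let \<open>g = P\<^sub>I(H) f\<close>, \<open>h = 1\<^sub>\<Omega> g\<close> and \<open>k = 1\<^sub>D g\<close>. Expanding the form at \<open>h = g - k\<close> and using
  \<open>\<langle>Hh,h\<rangle> \<ge> \<lambda>\<^sub>\<Omega> \<parallel>h\<parallel>\<^sup>2\<close>, \<open>\<langle>Hg,g\<rangle> \<le> max I \<parallel>g\<parallel>\<^sup>2\<close> and \<open>\<parallel>H\<parallel> \<le> N := \<parallel>H+1\<parallel>\<close>, one finds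
  \<open>(\<lambda>\<^sub>\<Omega> - max I) \<parallel>g\<parallel>\<^sup>2 \<le> (3 N + \<lambda>\<^sub>\<Omega>) \<parallel>g\<parallel> \<parallel>k\<parallel> \<le> 4 N (\<lambda>\<^sub>\<Omega> + 1) \<parallel>g\<parallel> \<parallel>k\<parallel>\<close>, where the last step uses \<open>N \<ge> 1\<close>.
  The bound \<open>\<langle>Hh,h\<rangle> \<ge> \<lambda>\<^sub>\<Omega> \<parallel>h\<parallel>\<^sup>2\<close> holds because the infimum of the numerical range of the bounded
  symmetric operator \<open>H\<^sub>\<Omega>\<close> lies in its spectrum, and because this spectrum is bounded below.
\<close>

section \<open>The weighted sequence space\<close>

text \<open>Once \<open>c > 0\<close> is known, the bound is the value at the minimiser
  \<open>t = - b / c\<close>. This is the common source of three Cauchy-Schwarz inequalities: for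
  \<open>ip\<close>, for the form of \<open>A - a\<close>, and for the edge weights at a
  vertex.\<close>

lemma quadratic_nonneg_discriminant:
  fixes a b c :: real
  assumes "\<And>t. 0 \<le> a + 2 * t * b + t\<^sup>2 * c"
  shows "b\<^sup>2 \<le> a * c"
proof (cases "c = 0")
  case True
  have "b = 0"
  proof (rule ccontr)
    assume "b \<noteq> 0"
    \<comment> \<open>With \<open>c = 0\<close> the polynomial is affine, and this \<open>t\<close>
      gives it the value -1.\<close>
    then have "2 * (- (a + 1) / (2 * b)) * b = - (a + 1)" by simp
    then show False
      using assms[of "- (a + 1) / (2 * b)"] True by simp
  qed
  then show ?thesis using True by simp
next
  case False
  have "c > 0"
  proof (rule ccontr)
    assume "\<not> c > 0"
    with False have c: "c < 0" by simp
    \<comment> \<open>For negative \<open>c\<close> the quadratic term has to win: \<open>t\<close>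
      is chosen with \<open>t |c| > |a| + 2 |b|\<close> and \<open>t >= 1\<close>, so that
      \<open>t^2 |c|\<close> exceeds \<open>a + 2 t b\<close>.\<close>
    define t where "t = (\<bar>a\<bar> + 2 * \<bar>b\<bar> + 1) / \<bar>c\<bar> + 1"
    have t1: "t \<ge> 1" unfolding t_def using c divide_nonneg_pos[of "\<bar>a\<bar> + 2 * \<bar>b\<bar> + 1" "\<bar>c\<bar>"] by linarith
    have "t * \<bar>c\<bar> > \<bar>a\<bar> + 2 * \<bar>b\<bar>" unfolding t_def using c by (simp add: field_simps)
    then have "t * (t * \<bar>c\<bar>) > t * (\<bar>a\<bar> + 2 * \<bar>b\<bar>)" using t1 by simp
    moreover have "t * \<bar>a\<bar> \<ge> a" using t1 mult_right_mono[of 1 t "\<bar>a\<bar>"] by simp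
    moreover have "t * \<bar>b\<bar> \<ge> t * b" using t1 by (simp add: mult_left_mono)
    ultimately show False
      using assms[of t] c by (simp add: power2_eq_square algebra_simps)
  qed
  then show ?thesis
    using assms[of "- b / c"] by (simp add: field_simps power2_eq_square)
qed

section \<open>Linear structure and inner product of the weighted space\<close>

locale weighted_l2 =
  fixes m :: "'x \<Rightarrow> real"
  assumes m_pos: "m x > 0"
begin

lemma L2_zero: "(\<lambda>x. 0) \<in> L2 m"
  by (simp add: L2_def)

lemma L2_scale: "f \<in> L2 m \<Longrightarrow> (\<lambda>x. c * f x) \<in> L2 m"
  unfolding L2_def
  by (auto simp: norm_mult power_mult_distrib mult.assoc intro: summable_on_cmult_right)

lemma L2_add:
  assumes "f \<in> L2 m" "g \<in> L2 m"
  shows "(\<lambda>x. f x + g x) \<in> L2 m"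
proof -
  have "(\<lambda>x. 2 * ((cmod (f x))\<^sup>2 * m x + (cmod (g x))\<^sup>2 * m x)) summable_on UNIV"
    using assms unfolding L2_def by (intro summable_on_cmult_right summable_on_add) auto
  moreover have "(cmod (f x + g x))\<^sup>2 * m x \<le> 2 * ((cmod (f x))\<^sup>2 * m x + (cmod (g x))\<^sup>2 * m x)" for x
  proof -
    have "(cmod (f x + g x))\<^sup>2 \<le> (cmod (f x) + cmod (g x))\<^sup>2"
      by (simp add: norm_triangle_ineq power_mono)
    also have "\<dots> \<le> 2 * ((cmod (f x))\<^sup>2 + (cmod (g x))\<^sup>2)"
      using sum_squares_bound[of "cmod (f x)" "cmod (g x)"] by (simp add: power2_sum)
    finally show ?thesis
      using mult_right_mono[of "(cmod (f x + g x))\<^sup>2" "2 * ((cmod (f x))\<^sup>2 + (cmod (g x))\<^sup>2)" "m x"]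
        m_pos[of x] by (simp add: algebra_simps del: mult_le_cancel_right mult_le_cancel_left)
  qed
  ultimately show ?thesis
    unfolding L2_def mem_Collect_eq using m_pos
    by (elim summable_on_comparison_test) (auto simp: less_imp_le)
qed

lemma L2_diff: "f \<in> L2 m \<Longrightarrow> g \<in> L2 m \<Longrightarrow> (\<lambda>x. f x - g x) \<in> L2 m"
  using L2_add[of f "\<lambda>x. (-1) * g x"] L2_scale[of g "-1"] by simp

lemma L2_mono:
  assumes "g \<in> L2 m" "\<And>x. cmod (f x) \<le> cmod (g x)"
  shows "f \<in> L2 m"
  using assms(1) unfolding L2_def mem_Collect_eq
  by (rule summable_on_comparison_test)
     (use assms(2) m_pos in \<open>auto simp: less_imp_le intro!: mult_right_mono power_mono\<close>)

lemma ip_summable: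
  assumes "f \<in> L2 m" "g \<in> L2 m"
  shows "(\<lambda>x. f x * cnj (g x) * complex_of_real (m x)) summable_on UNIV"
proof -
  have "(\<lambda>x. (cmod (f x))\<^sup>2 * m x + (cmod (g x))\<^sup>2 * m x) summable_on UNIV"
    using assms unfolding L2_def by (intro summable_on_add) auto
  then have "(\<lambda>x. norm (f x * cnj (g x) * complex_of_real (m x))) summable_on UNIV"
  proof (rule Infinite_Sum.abs_summable_on_comparison_test')
    fix x
    have "cmod (f x) * cmod (g x) \<le> (cmod (f x))\<^sup>2 + (cmod (g x))\<^sup>2"
      using sum_squares_bound[of "cmod (f x)" "cmod (g x)"]
        mult_nonneg_nonneg[of "cmod (f x)" "cmod (g x)"] by (auto simp del: mult_nonneg_nonneg)
    then show "norm (f x * cnj (g x) * complex_of_real (m x)) \<le> (cmod (f x))\<^sup>2 * m x + (cmod (g x))\<^sup>2 * m x"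
      using mult_right_mono[of "cmod (f x) * cmod (g x)" "(cmod (f x))\<^sup>2 + (cmod (g x))\<^sup>2" "m x"]
        m_pos[of x] by (simp add: norm_mult distrib_right del: mult_le_cancel_right mult_le_cancel_left)
  qed
  then show ?thesis by (rule abs_summable_summable)
qed

lemma ip_add_left:
  assumes "f \<in> L2 m" "g \<in> L2 m" "h \<in> L2 m"
  shows "ip m (\<lambda>x. f x + g x) h = ip m f h + ip m g h"
  unfolding ip_def using infsum_add[OF ip_summable[OF assms(1,3)] ip_summable[OF assms(2,3)]]
  by (simp add: algebra_simps)

lemma ip_scale_left: "ip m (\<lambda>x. c * f x) h = c * ip m f h"
  unfolding ip_def by (simp add: mult.assoc infsum_cmult_right')

lemma ip_commute: "ip m g f = cnj (ip m f g)"
  unfolding ip_def by (subst infsum_cnj[symmetric]) (simp add: mult_ac)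

lemma ip_diff_left:
  assumes "f \<in> L2 m" "g \<in> L2 m" "h \<in> L2 m"
  shows "ip m (\<lambda>x. f x - g x) h = ip m f h - ip m g h"
  using ip_add_left[OF assms(1) L2_scale[OF assms(2), of "-1"] assms(3)] ip_scale_left[of "-1" g h]
  by simp

lemma ip_add_right:
  assumes "f \<in> L2 m" "g \<in> L2 m" "h \<in> L2 m"
  shows "ip m h (\<lambda>x. f x + g x) = ip m h f + ip m h g"
  unfolding ip_commute[of h] by (simp add: ip_add_left[OF assms])

lemma ip_diff_right:
  assumes "f \<in> L2 m" "g \<in> L2 m" "h \<in> L2 m"
  shows "ip m h (\<lambda>x. f x - g x) = ip m h f - ip m h g"
  unfolding ip_commute[of h] by (simp add: ip_diff_left[OF assms])

lemma ip_scale_right: "ip m h (\<lambda>x. c * f x) = cnj c * ip m h f"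
  unfolding ip_commute[of h] by (simp add: ip_scale_left)

text \<open>Covers every \<open>f\<close>: outside \<open>L2 m\<close> neither series converges, and
  both sides are the default value 0 of \<open>infsum\<close>. The norm identities derived from it
  can thus be stated without membership.\<close>

lemma ip_self: "ip m f f = complex_of_real (\<Sum>\<^sub>\<infinity>x. (cmod (f x))\<^sup>2 * m x)"
proof (cases "f \<in> L2 m")
  case True
  then have "((\<lambda>x. (cmod (f x))\<^sup>2 * m x) has_sum (\<Sum>\<^sub>\<infinity>x. (cmod (f x))\<^sup>2 * m x)) UNIV"
    unfolding L2_def by (simp add: has_sum_infsum)
  from has_sum_of_real[OF this, where 'a=complex] show ?thesis
    unfolding ip_def of_real_mult complex_norm_square by (rule infsumI)
next
  case False
  then have "\<not> (\<lambda>x. f x * cnj (f x) * complex_of_real (m x)) summable_on UNIV"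
    using summable_on_Re[of "\<lambda>x. f x * cnj (f x) * complex_of_real (m x)" UNIV]
    by (auto simp: L2_def complex_norm_square[symmetric])
  with False show ?thesis
    unfolding ip_def L2_def by (simp add: infsum_not_exists)
qed

section \<open>The weighted norm\<close>

lemma l2norm_square: "(l2norm m f)\<^sup>2 = Re (ip m f f)"
  unfolding l2norm_def ip_self using m_pos
  by (simp add: infsum_nonneg less_imp_le)

lemma l2norm_square_infsum: "(l2norm m f)\<^sup>2 = (\<Sum>\<^sub>\<infinity>x. (cmod (f x))\<^sup>2 * m x)"
  by (simp add: l2norm_square ip_self)

lemma l2norm_nonneg: "0 \<le> l2norm m f"
  unfolding l2norm_def ip_self using m_pos by (simp add: infsum_nonneg less_imp_le)

lemma point_le_l2norm:
  assumes "f \<in> L2 m"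
  shows "(cmod (f x))\<^sup>2 * m x \<le> (l2norm m f)\<^sup>2"
proof -
  have "sum (\<lambda>x. (cmod (f x))\<^sup>2 * m x) {x} \<le> (\<Sum>\<^sub>\<infinity>x. (cmod (f x))\<^sup>2 * m x)"
    using assms m_pos unfolding L2_def
    by (intro finite_sum_le_infsum) (auto simp: less_imp_le)
  then show ?thesis by (simp add: l2norm_square_infsum)
qed

text \<open>Every point carries positive mass, so point evaluations are bounded. This turns Cauchy
  sequences in norm into pointwise Cauchy sequences.\<close>

lemma cmod_le_l2norm:
  assumes "f \<in> L2 m"
  shows "cmod (f x) \<le> l2norm m f / sqrt (m x)"
proof -
  have "(cmod (f x) * sqrt (m x))\<^sup>2 \<le> (l2norm m f)\<^sup>2"
    using point_le_l2norm[OF assms, of x] m_pos[of x] by (simp add: power_mult_distrib)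
  then have "cmod (f x) * sqrt (m x) \<le> l2norm m f"
    using l2norm_nonneg power2_le_imp_le by blast
  then show ?thesis using m_pos[of x] by (simp add: field_simps)
qed

lemma l2norm_zero_imp:
  assumes "f \<in> L2 m" "l2norm m f = 0"
  shows "f = (\<lambda>x. 0)"
  using cmod_le_l2norm[OF assms(1)] assms(2) by auto

lemma l2norm_mono:
  assumes "g \<in> L2 m" "\<And>x. cmod (f x) \<le> cmod (g x)"
  shows "l2norm m f \<le> l2norm m g"
proof -
  have "(l2norm m f)\<^sup>2 \<le> (l2norm m g)\<^sup>2"
    unfolding l2norm_square_infsum using L2_mono[OF assms] assms m_pos unfolding L2_def
    by (intro infsum_mono) (auto simp: less_imp_le intro!: mult_right_mono power_mono)
  then show ?thesis using l2norm_nonneg power2_le_imp_le by blast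
qed

lemma l2norm_scale: "l2norm m (\<lambda>x. c * f x) = cmod c * l2norm m f"
proof -
  have "(l2norm m (\<lambda>x. c * f x))\<^sup>2 = (cmod c * l2norm m f)\<^sup>2"
    by (simp add: l2norm_square_infsum norm_mult power_mult_distrib mult.assoc infsum_cmult_right')
  then show ?thesis using l2norm_nonneg by (simp add: power2_eq_iff_nonneg)
qed

lemma l2norm_add_square:
  assumes "f \<in> L2 m" "g \<in> L2 m"
  shows "(l2norm m (\<lambda>x. f x + g x))\<^sup>2 = (l2norm m f)\<^sup>2 + 2 * Re (ip m f g) + (l2norm m g)\<^sup>2"
proof -
  have "Re (ip m g f) = Re (ip m f g)" by (subst ip_commute) simp
  then show ?thesis
    using assms by (simp add: l2norm_square ip_add_left ip_add_right L2_add)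
qed

text \<open>The squared norm of \<open>f + t g\<close> is a nonnegative quadratic polynomial in real
  \<open>t\<close>, and its discriminant gives the estimate.\<close>

lemma Re_ip_le:
  assumes "f \<in> L2 m" "g \<in> L2 m"
  shows "\<bar>Re (ip m f g)\<bar> \<le> l2norm m f * l2norm m g"
proof -
  have "(Re (ip m f g))\<^sup>2 \<le> (l2norm m f)\<^sup>2 * (l2norm m g)\<^sup>2"
  proof (rule quadratic_nonneg_discriminant)
    fix t
    show "0 \<le> (l2norm m f)\<^sup>2 + 2 * t * Re (ip m f g) + t\<^sup>2 * (l2norm m g)\<^sup>2"
      using l2norm_add_square[OF assms(1) L2_scale[OF assms(2), of "complex_of_real t"]]
        zero_le_power2[of "l2norm m (\<lambda>x. f x + complex_of_real t * g x)"]
      by (simp add: l2norm_scale ip_scale_right power_mult_distrib)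
  qed
  then have "\<bar>Re (ip m f g)\<bar>\<^sup>2 \<le> (l2norm m f * l2norm m g)\<^sup>2"
    by (simp add: power_mult_distrib)
  then show ?thesis
    using l2norm_nonneg by (meson mult_nonneg_nonneg power2_le_imp_le)
qed

lemma l2norm_triangle:
  assumes "f \<in> L2 m" "g \<in> L2 m"
  shows "l2norm m (\<lambda>x. f x + g x) \<le> l2norm m f + l2norm m g"
proof -
  have "(l2norm m (\<lambda>x. f x + g x))\<^sup>2 \<le> (l2norm m f + l2norm m g)\<^sup>2"
    using Re_ip_le[OF assms] by (simp add: l2norm_add_square[OF assms] power2_sum)
  then show ?thesis
    using l2norm_nonneg by (meson add_nonneg_nonneg power2_le_imp_le)
qed

lemma l2norm_triangle_diff:
  assumes "f \<in> L2 m" "g \<in> L2 m"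
  shows "l2norm m (\<lambda>x. f x - g x) \<le> l2norm m f + l2norm m g"
  using l2norm_triangle[OF assms(1) L2_scale[OF assms(2), of "-1"]] l2norm_scale[of "-1" g] by simp

text \<open>Testing against point masses determines a function; this yields uniqueness of the
  operator associated with the form.\<close>

lemma ip_delta: "ip m f (\<lambda>y. if y = x then 1 else 0) = f x * complex_of_real (m x)"
proof -
  have "ip m f (\<lambda>y. if y = x then 1 else 0)
      = (\<Sum>\<^sub>\<infinity>y\<in>{x}. f y * cnj (if y = x then 1 else 0) * complex_of_real (m y))"
    unfolding ip_def by (rule infsum_cong_neutral) auto
  then show ?thesis by simp
qed

lemma L2_delta: "(\<lambda>y. if y = x then 1 else 0) \<in> L2 m"
  unfolding L2_def mem_Collect_eq
  by (rule finite_nonzero_values_imp_summable_on, rule finite_subset[of _ "{x}"]) auto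

text \<open>A Fatou argument: each finite partial sum for \<open>u\<close> is a limit of partial
  sums for \<open>h n\<close>, all at most \<open>K^2\<close>, and a nonnegative sum is the supremum
  of its finite partial sums. It takes the place of completeness.\<close>

lemma L2_pointwise_limit:
  assumes "\<And>n. h n \<in> L2 m" "\<And>n. l2norm m (h n) \<le> K" "\<And>x. (\<lambda>n. h n x) \<longlonglongrightarrow> u x"
  shows "u \<in> L2 m" "l2norm m u \<le> K"
proof -
  have bound: "(\<Sum>x\<in>F. (cmod (u x))\<^sup>2 * m x) \<le> K\<^sup>2" if "finite F" for F
  proof (rule LIMSEQ_le_const2)
    show "(\<lambda>n. \<Sum>x\<in>F. (cmod (h n x))\<^sup>2 * m x) \<longlonglongrightarrow> (\<Sum>x\<in>F. (cmod (u x))\<^sup>2 * m x)"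
      using assms(3) by (intro tendsto_intros)
    have "(\<Sum>x\<in>F. (cmod (h n x))\<^sup>2 * m x) \<le> K\<^sup>2" for n
    proof -
      have "(\<Sum>x\<in>F. (cmod (h n x))\<^sup>2 * m x) \<le> (l2norm m (h n))\<^sup>2"
        unfolding l2norm_square_infsum using assms(1)[of n] m_pos that unfolding L2_def
        by (intro finite_sum_le_infsum) (auto simp: less_imp_le)
      also have "\<dots> \<le> K\<^sup>2" using assms(2)[of n] l2norm_nonneg power_mono by blast
      finally show ?thesis .
    qed
    then show "\<exists>N. \<forall>n\<ge>N. (\<Sum>x\<in>F. (cmod (h n x))\<^sup>2 * m x) \<le> K\<^sup>2" by blast
  qed
  have summ: "(\<lambda>x. (cmod (u x))\<^sup>2 * m x) summable_on UNIV"
    using bound m_pos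
    by (intro nonneg_bdd_above_summable_on) (auto simp: less_imp_le intro!: bdd_aboveI2)
  then show "u \<in> L2 m" by (simp add: L2_def)
  have "(l2norm m u)\<^sup>2 \<le> K\<^sup>2"
    unfolding l2norm_square_infsum using infsum_le_finite_sums[OF summ] bound by blast
  moreover have "K \<ge> 0" using assms(2)[of 0] l2norm_nonneg[of "h 0"] by linarith
  ultimately show "l2norm m u \<le> K" using power2_le_imp_le by blast
qed

section \<open>The subspace of functions vanishing on \<open>D\<close>\<close>

lemma L2_Omega_L2: "f \<in> L2_Omega m D \<Longrightarrow> f \<in> L2 m"
  by (simp add: L2_Omega_def)

lemma L2_Omega_zero: "(\<lambda>x. 0) \<in> L2_Omega m D"
  by (simp add: L2_Omega_def L2_zero)

lemma L2_Omega_add: "f \<in> L2_Omega m D \<Longrightarrow> g \<in> L2_Omega m D \<Longrightarrow> (\<lambda>x. f x + g x) \<in> L2_Omega m D"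
  by (simp add: L2_Omega_def L2_add)

lemma L2_Omega_diff: "f \<in> L2_Omega m D \<Longrightarrow> g \<in> L2_Omega m D \<Longrightarrow> (\<lambda>x. f x - g x) \<in> L2_Omega m D"
  by (simp add: L2_Omega_def L2_diff)

lemma L2_Omega_scale: "f \<in> L2_Omega m D \<Longrightarrow> (\<lambda>x. c * f x) \<in> L2_Omega m D"
  by (simp add: L2_Omega_def L2_scale)

lemma L2_restrict: "f \<in> L2 m \<Longrightarrow> (\<lambda>x. if x \<in> S then 0 else f x) \<in> L2_Omega m S"
  using L2_mono[of f "\<lambda>x. if x \<in> S then 0 else f x"] by (simp add: L2_Omega_def)

text \<open>Cutting off on \<open>D\<close> is the orthogonal projection onto
  \<open>L2_Omega m D\<close>, hence invisible when tested inside that subspace.\<close>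

lemma ip_restrict:
  assumes "g \<in> L2_Omega m D"
  shows "ip m (\<lambda>x. if x \<in> D then 0 else f x) g = ip m f g"
  unfolding ip_def using assms by (intro infsum_cong) (auto simp: L2_Omega_def)

text \<open>Neumann series for \<open>1 - T\<close> with \<open>T\<close> of norm at most 1/2. The
  limit is first built pointwise and then placed in the subspace by
  \<open>L2_pointwise_limit\<close>.\<close>

lemma contraction_fixpoint:
  assumes T_in: "\<And>f. f \<in> L2_Omega m D \<Longrightarrow> T f \<in> L2_Omega m D"
    and T_diff: "\<And>f g. f \<in> L2_Omega m D \<Longrightarrow> g \<in> L2_Omega m D \<Longrightarrow> T (\<lambda>x. f x - g x) = (\<lambda>x. T f x - T g x)"
    and T_le: "\<And>f. f \<in> L2_Omega m D \<Longrightarrow> l2norm m (T f) \<le> l2norm m f / 2"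
    and f: "f \<in> L2_Omega m D"
  obtains u where "u \<in> L2_Omega m D" "l2norm m u \<le> 2 * l2norm m f" "(\<lambda>x. u x - T u x) = f"
proof -
  \<comment> \<open>The affine iteration started at 0 produces the partial sums
    \<open>f + T f + ... + T^(n-1) f\<close>.\<close>
  define S where "S = rec_nat (\<lambda>x. 0) (\<lambda>_ u x. f x + T u x)"
  have S_0: "S 0 = (\<lambda>x. 0)" and S_Suc: "S (Suc n) = (\<lambda>x. f x + T (S n) x)" for n
    by (simp_all add: S_def)
  have S_in: "S n \<in> L2_Omega m D" for n
    by (induction n) (simp_all only: S_0 S_Suc L2_Omega_zero L2_Omega_add[OF f T_in])
  have S_norm: "l2norm m (S n) \<le> 2 * l2norm m f" for n
  proof (induction n)
    case 0
    show ?case using l2norm_scale[of 0 f] l2norm_nonneg[of f] by (simp add: S_0)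
  next
    case (Suc n)
    show ?case
      using l2norm_triangle[OF L2_Omega_L2[OF f] L2_Omega_L2[OF T_in[OF S_in]], of n] T_le[OF S_in, of n] Suc
      by (simp add: S_Suc)
  qed
  have S_Cauchy: "l2norm m (\<lambda>x. S (n + k) x - S n x) \<le> 2 * l2norm m f / 2 ^ n" for n k
  proof (induction n)
    case 0
    show ?case using S_norm[of k] by (simp add: S_0)
  next
    case (Suc n)
    \<comment> \<open>The summand \<open>f\<close> cancels, so one more step of the iteration
      applies \<open>T\<close> to the difference and halves the bound.\<close>
    have "(\<lambda>x. S (Suc n + k) x - S (Suc n) x) = T (\<lambda>x. S (n + k) x - S n x)"
      using T_diff[OF S_in S_in, of "n + k" n] by (simp add: S_Suc)
    then show ?case
      using T_le[OF L2_Omega_diff[OF S_in S_in], of "n + k" n] Suc by simp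
  qed
  have S_point: "cmod (S (n + k) x - S n x) \<le> 2 * l2norm m f / 2 ^ n / sqrt (m x)" for n k x
    using cmod_le_l2norm[OF L2_Omega_L2[OF L2_Omega_diff[OF S_in[of "n + k"] S_in[of n]]], of x]
      divide_right_mono[OF S_Cauchy[of n k], of "sqrt (m x)"] m_pos[of x] by simp
  have "Cauchy (\<lambda>n. S n x)" for x
  proof (rule metric_CauchyI)
    fix e :: real assume e: "0 < e"
    define K where "K = 2 * l2norm m f / sqrt (m x)"
    have "(\<lambda>n. K * (1/2) ^ n) \<longlonglongrightarrow> K * 0"
      by (intro tendsto_mult tendsto_const LIMSEQ_realpow_zero) auto
    then have "eventually (\<lambda>n. K * (1/2) ^ n < e / 2) sequentially"
      using e by (intro order_tendstoD(2)) auto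
    then obtain N where N: "K * (1/2) ^ N < e / 2"
      by (auto simp: eventually_sequentially)
    have *: "dist (S n x) (S N x) < e / 2" if "n \<ge> N" for n
    proof -
      have "2 * l2norm m f / 2 ^ N / sqrt (m x) = K * (1/2) ^ N"
        by (simp add: K_def power_divide mult.commute)
      then show ?thesis
        using S_point[of N "n - N" x] N that by (simp add: dist_norm)
    qed
    show "\<exists>N. \<forall>i\<ge>N. \<forall>j\<ge>N. dist (S i x) (S j x) < e"
      using * by (meson dist_triangle_half_l)
  qed
  then have "\<exists>l. (\<lambda>n. S n x) \<longlonglongrightarrow> l" for x
    by (simp add: Cauchy_convergent_iff convergent_def)
  then obtain u where u: "\<And>x. (\<lambda>n. S n x) \<longlonglongrightarrow> u x"
    by metis
  have u_in: "u \<in> L2_Omega m D"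
  proof -
    have "u x = 0" if "x \<in> D" for x
      using u[of x] S_in that by (auto simp: L2_Omega_def LIMSEQ_const_iff)
    then show ?thesis
      using L2_pointwise_limit(1)[OF L2_Omega_L2[OF S_in] S_norm u] by (simp add: L2_Omega_def)
  qed
  \<comment> \<open>For fixed \<open>n\<close> the Cauchy estimate is uniform in \<open>k\<close>
    and survives the pointwise limit in \<open>k\<close>.\<close>
  have u_S: "l2norm m (\<lambda>x. u x - S n x) \<le> 2 * l2norm m f / 2 ^ n" for n
  proof (rule L2_pointwise_limit(2))
    show "(\<lambda>x. S (n + k) x - S n x) \<in> L2 m" for k
      by (rule L2_Omega_L2[OF L2_Omega_diff[OF S_in S_in]])
    show "(\<lambda>k. S (n + k) x - S n x) \<longlonglongrightarrow> u x - S n x" for x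
      using LIMSEQ_ignore_initial_segment[OF u[of x], of n]
      by (intro tendsto_diff tendsto_const) (simp add: add.commute)
  qed (rule S_Cauchy)
  \<comment> \<open>\<open>T\<close> need not respect pointwise limits, so the equation comes from a
    norm estimate of the residual: it equals \<open>(u - S (n+1)) - T (u - S n)\<close>, and each of
    the two errors is at most \<open>||f|| / 2^n\<close>.\<close>
  define r where "r = (\<lambda>x. u x - T u x - f x)"
  have r_in: "r \<in> L2_Omega m D"
    unfolding r_def by (intro L2_Omega_diff u_in T_in f)
  have r_le: "l2norm m r \<le> 2 * l2norm m f * (1/2) ^ n" for n
  proof -
    have V: "(\<lambda>x. u x - S (Suc n) x) \<in> L2_Omega m D" "(\<lambda>x. u x - S n x) \<in> L2_Omega m D"
      by (intro L2_Omega_diff u_in S_in)+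
    have "r = (\<lambda>x. (u x - S (Suc n) x) - T (\<lambda>x. u x - S n x) x)"
      unfolding r_def S_Suc T_diff[OF u_in S_in] by (simp add: algebra_simps)
    then have "l2norm m r \<le> l2norm m (\<lambda>x. u x - S (Suc n) x) + l2norm m (T (\<lambda>x. u x - S n x))"
      using l2norm_triangle_diff[OF L2_Omega_L2[OF V(1)] L2_Omega_L2[OF T_in[OF V(2)]]] by simp
    then show ?thesis
      using u_S[of n] u_S[of "Suc n"] T_le[OF V(2)] by (simp add: power_divide)
  qed
  have "(\<lambda>n. 2 * l2norm m f * (1/2) ^ n) \<longlonglongrightarrow> 2 * l2norm m f * 0"
    by (intro tendsto_mult tendsto_const LIMSEQ_realpow_zero) auto
  then have "l2norm m r \<le> 2 * l2norm m f * 0"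
    using r_le LIMSEQ_le_const by blast
  then have "r = (\<lambda>x. 0)"
    using l2norm_zero_imp[OF L2_Omega_L2[OF r_in]] l2norm_nonneg[of r] by simp
  then have "(\<lambda>x. u x - T u x) = f"
    unfolding r_def by (simp add: fun_eq_iff)
  then show ?thesis
    using that u_in u_S[of 0] by (simp add: S_0)
qed

end

section \<open>Numerical range and spectrum\<close>

text \<open>Linearity is asked only on \<open>L2_Omega m D\<close>, because \<open>H_Omega\<close>
  is the zero map outside that subspace.\<close>

locale bounded_symmetric_op = weighted_l2 m for m :: "'x \<Rightarrow> real" +
  fixes D :: "'x set" and A :: "('x \<Rightarrow> complex) \<Rightarrow> 'x \<Rightarrow> complex" and M :: real
  assumes A_in: "f \<in> L2_Omega m D \<Longrightarrow> A f \<in> L2_Omega m D"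
    and A_add: "f \<in> L2_Omega m D \<Longrightarrow> g \<in> L2_Omega m D \<Longrightarrow> A (\<lambda>x. f x + g x) = (\<lambda>x. A f x + A g x)"
    and A_scale: "f \<in> L2_Omega m D \<Longrightarrow> A (\<lambda>x. c * f x) = (\<lambda>x. c * A f x)"
    and A_bound: "f \<in> L2_Omega m D \<Longrightarrow> l2norm m (A f) \<le> M * l2norm m f"
    and A_sym: "f \<in> L2_Omega m D \<Longrightarrow> g \<in> L2_Omega m D \<Longrightarrow> ip m (A f) g = ip m f (A g)"
begin

lemma A_diff: "f \<in> L2_Omega m D \<Longrightarrow> g \<in> L2_Omega m D \<Longrightarrow> A (\<lambda>x. f x - g x) = (\<lambda>x. A f x - A g x)"
  using A_add[of f "\<lambda>x. (-1) * g x"] A_scale[of g "-1"] L2_Omega_scale[of g D "-1"] by simp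

text \<open>Write \<open>A - t = -t (1 - A / t)\<close>. Since \<open>A / t\<close> has norm at most
  1/2, the Neumann series inverts the second factor. The purpose is a lower bound for the real
  spectrum, without which its \<open>Inf\<close> would carry no information.\<close>

lemma far_negative_not_in_spectrum:
  assumes t: "t < 0" "2 * M \<le> - t"
  shows "complex_of_real t \<notin> spectrum_on m (L2_Omega m D) A"
proof -
  let ?V = "L2_Omega m D" and ?s = "complex_of_real (1 / t)"
  define T where "T = (\<lambda>f x. ?s * A f x)"
  have T_in: "T f \<in> ?V" if "f \<in> ?V" for f
    unfolding T_def by (intro L2_Omega_scale A_in that)
  have T_diff: "T (\<lambda>x. f x - g x) = (\<lambda>x. T f x - T g x)" if "f \<in> ?V" "g \<in> ?V" for f g
    unfolding T_def A_diff[OF that] by (simp add: algebra_simps)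
  have T_le: "l2norm m (T f) \<le> l2norm m f / 2" if "f \<in> ?V" for f
  proof -
    have "l2norm m (T f) = l2norm m (A f) / (- t)"
      unfolding T_def l2norm_scale using t by (simp add: norm_divide)
    also have "\<dots> \<le> M * l2norm m f / (- t)"
      using A_bound[OF that] t by (intro divide_right_mono) auto
    also have "\<dots> \<le> l2norm m f / 2"
      using mult_right_mono[OF t(2) l2norm_nonneg[of f]] t by (simp add: field_simps)
    finally show ?thesis .
  qed
  have "\<exists>u. u \<in> ?V \<and> l2norm m u \<le> 2 * l2norm m f \<and> (\<lambda>x. u x - T u x) = f" if "f \<in> ?V" for f
    using contraction_fixpoint[of D T f, OF T_in T_diff T_le that] by blast
  then obtain R where R: "\<And>f. f \<in> ?V \<Longrightarrow> R f \<in> ?V" "\<And>f. f \<in> ?V \<Longrightarrow> l2norm m (R f) \<le> 2 * l2norm m f"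
      "\<And>f. f \<in> ?V \<Longrightarrow> (\<lambda>x. R f x - T (R f) x) = f"
    by metis
  \<comment> \<open>So far \<open>R\<close> is only a right inverse of \<open>1 - T\<close>. It is
    also a left inverse because \<open>1 - T\<close> is injective: a vector fixed by
    \<open>T\<close> has norm at most half its own norm.\<close>
  have R_left: "R (\<lambda>x. f x - T f x) = f" if f: "f \<in> ?V" for f
  proof -
    let ?g = "\<lambda>x. f x - T f x"
    have g: "?g \<in> ?V" by (intro L2_Omega_diff f T_in)
    let ?d = "\<lambda>x. R ?g x - f x"
    have d: "?d \<in> ?V" by (intro L2_Omega_diff R f g)
    have "T ?d = ?d"
      using R(3)[OF g] unfolding T_diff[OF R(1)[OF g] f] by (simp add: fun_eq_iff algebra_simps)
    then have "l2norm m ?d = 0"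
      using T_le[OF d] l2norm_nonneg[of ?d] by simp
    then show ?thesis
      using l2norm_zero_imp[OF L2_Omega_L2[OF d]] by (simp add: fun_eq_iff)
  qed
  \<comment> \<open>The factor \<open>-1/t\<close> converts the inverse of \<open>1 - A / t\<close>
    into the inverse of \<open>A - t\<close>.\<close>
  define B where "B = (\<lambda>f. R (\<lambda>x. - ?s * f x))"
  have "B f \<in> ?V" if "f \<in> ?V" for f
    unfolding B_def by (intro R L2_Omega_scale that)
  moreover have "l2norm m (B f) \<le> (2 * cmod ?s) * l2norm m f" if "f \<in> ?V" for f
    using R(2)[OF L2_Omega_scale[OF that, of "- ?s"]] unfolding B_def l2norm_scale
    by simp
  moreover have "B (\<lambda>x. A f x - complex_of_real t * f x) = f" if "f \<in> ?V" for f
  proof -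
    have "(\<lambda>x. - ?s * (A f x - complex_of_real t * f x)) = (\<lambda>x. f x - T f x)"
      using t by (simp add: T_def fun_eq_iff field_simps)
    then show ?thesis unfolding B_def by (simp only: R_left[OF that])
  qed
  moreover have "(\<lambda>x. A (B f) x - complex_of_real t * B f x) = f" if "f \<in> ?V" for f
  proof -
    have "B f x - ?s * A (B f) x = - ?s * f x" for x
      using fun_cong[OF R(3)[OF L2_Omega_scale[OF that, of "- ?s"]], of x]
      unfolding B_def T_def by simp
    then have "complex_of_real t * (B f x - ?s * A (B f) x) = complex_of_real t * (- ?s * f x)" for x
      by (simp only:)
    then show ?thesis using t by (simp add: fun_eq_iff algebra_simps)
  qed
  ultimately show ?thesis
    unfolding spectrum_on_def by blast
qed

lemma quadratic_form_le:
  assumes "f \<in> L2_Omega m D"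
  shows "\<bar>Re (ip m (A f) f)\<bar> \<le> M * (l2norm m f)\<^sup>2"
proof -
  have "\<bar>Re (ip m (A f) f)\<bar> \<le> l2norm m (A f) * l2norm m f"
    using Re_ip_le[OF L2_Omega_L2[OF A_in[OF assms]] L2_Omega_L2[OF assms]] .
  also have "\<dots> \<le> M * l2norm m f * l2norm m f"
    using A_bound[OF assms] l2norm_nonneg by (intro mult_right_mono)
  finally show ?thesis by (simp add: power2_eq_square mult.assoc)
qed

lemma quadratic_form_add_scale:
  assumes V: "f \<in> L2_Omega m D" "g \<in> L2_Omega m D"
  shows "Re (ip m (A (\<lambda>x. f x + complex_of_real t * g x)) (\<lambda>x. f x + complex_of_real t * g x))
      = Re (ip m (A f) f) + 2 * t * Re (ip m (A f) g) + t\<^sup>2 * Re (ip m (A g) g)"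
proof -
  have g': "(\<lambda>x. complex_of_real t * g x) \<in> L2_Omega m D" by (rule L2_Omega_scale[OF V(2)])
  have "Re (ip m (A g) f) = Re (ip m (A f) g)"
    unfolding A_sym[OF V(2,1)] by (subst ip_commute) simp
  then show ?thesis
    unfolding A_add[OF V(1) g'] A_scale[OF V(2)]
    using L2_Omega_L2[OF V(1)] L2_Omega_L2[OF V(2)] L2_Omega_L2[OF A_in[OF V(1)]] L2_Omega_L2[OF A_in[OF V(2)]]
    by (simp add: ip_add_left ip_add_right ip_scale_left ip_scale_right L2_add L2_scale algebra_simps power2_eq_square)
qed

text \<open>With \<open>s f = \<langle>A f, f\<rangle> - a \<parallel>f\<parallel>\<^sup>2 \<ge> 0\<close> and \<open>w = A f - a f\<close>, Cauchy-Schwarz for the form of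
  \<open>A - a\<close> gives \<open>\<parallel>w\<parallel>\<^sup>4 \<le> s f * s w\<close>. A bounded inverse of \<open>A - a\<close> would therefore bound \<open>s\<close>
  away from zero on the unit sphere.\<close>
lemma numerical_range_Inf_in_spectrum:
  assumes e: "e \<in> L2_Omega m D" "l2norm m e \<noteq> 0"
  defines "R \<equiv> {Re (ip m (A f) f) | f. f \<in> L2_Omega m D \<and> l2norm m f = 1}"
  shows "complex_of_real (Inf R) \<in> spectrum_on m (L2_Omega m D) A"
    and "f \<in> L2_Omega m D \<Longrightarrow> Inf R * (l2norm m f)\<^sup>2 \<le> Re (ip m (A f) f)"
proof -
  let ?V = "L2_Omega m D"
  have normalize: "(\<lambda>x. complex_of_real (1 / l2norm m f) * f x) \<in> ?V"
      "l2norm m (\<lambda>x. complex_of_real (1 / l2norm m f) * f x) = 1"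
    if "f \<in> ?V" "l2norm m f \<noteq> 0" for f
    using that l2norm_nonneg[of f] L2_Omega_scale[OF that(1)] unfolding l2norm_scale
    by (simp_all add: norm_divide del: of_real_divide)
  have R_ne: "R \<noteq> {}" unfolding R_def using normalize[OF e] by blast
  have R_bdd: "bdd_below R"
  proof (rule bdd_belowI)
    fix r assume "r \<in> R"
    then show "- M \<le> r" unfolding R_def using quadratic_form_le by fastforce
  qed
  define a where "a = Inf R"
  have below: "a * (l2norm m f)\<^sup>2 \<le> Re (ip m (A f) f)" if f: "f \<in> ?V" for f
  proof (cases "l2norm m f = 0")
    case True
    then show ?thesis using quadratic_form_le[OF f] by simp
  next
    case False
    let ?c = "complex_of_real (1 / l2norm m f)"
    have "Re (ip m (A (\<lambda>x. ?c * f x)) (\<lambda>x. ?c * f x)) \<in> R"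
      unfolding R_def using normalize[OF f False] by blast
    then have "a \<le> Re (ip m (A (\<lambda>x. ?c * f x)) (\<lambda>x. ?c * f x))"
      unfolding a_def using R_bdd by (rule cInf_lower)
    also have "\<dots> = Re (ip m (A f) f) / (l2norm m f)\<^sup>2"
      unfolding A_scale[OF f] ip_scale_left ip_scale_right by (simp add: power2_eq_square)
    finally show ?thesis using False by (simp add: field_simps)
  qed
  then show "f \<in> ?V \<Longrightarrow> Inf R * (l2norm m f)\<^sup>2 \<le> Re (ip m (A f) f)"
    by (simp add: a_def)
  have "complex_of_real a \<in> spectrum_on m ?V A"
  proof (rule ccontr)
    assume "complex_of_real a \<notin> spectrum_on m ?V A"
    then obtain B C where C: "\<forall>f\<in>?V. l2norm m (B f) \<le> C * l2norm m f"
      and B: "\<forall>f\<in>?V. B (\<lambda>x. A f x - complex_of_real a * f x) = f"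
      unfolding spectrum_on_def by blast
    \<comment> \<open>\<open>C\<close> bounds the assumed inverse and \<open>M + |a|\<close> bounds
      the form of \<open>A - a\<close>; together they turn \<open>||w||^4 <= s f * s w\<close> into
      \<open>1 <= N * s f\<close>.\<close>
    define N where "N = C\<^sup>2 * (M + \<bar>a\<bar>)"
    have gap: "1 \<le> N * (Re (ip m (A f) f) - a)" if f: "f \<in> ?V" "l2norm m f = 1" for f
    proof -
      define s where "s g = Re (ip m (A g) g) - a * (l2norm m g)\<^sup>2" for g
      define w where "w = (\<lambda>x. A f x - complex_of_real a * f x)"
      have w: "w \<in> ?V" unfolding w_def by (intro L2_Omega_diff A_in L2_Omega_scale f)
      have s_nonneg: "0 \<le> s g" if "g \<in> ?V" for g using below[OF that] by (simp add: s_def)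
      have "(Re (ip m w w))\<^sup>2 \<le> s f * s w"
      proof (rule quadratic_nonneg_discriminant)
        fix t
        have tw: "(\<lambda>x. complex_of_real t * w x) \<in> ?V" by (rule L2_Omega_scale[OF w])
        have *: "(l2norm m (\<lambda>x. f x + complex_of_real t * w x))\<^sup>2
            = (l2norm m f)\<^sup>2 + 2 * t * Re (ip m f w) + t\<^sup>2 * (l2norm m w)\<^sup>2"
          unfolding l2norm_add_square[OF L2_Omega_L2[OF f(1)] L2_Omega_L2[OF tw]] ip_scale_right l2norm_scale
          by (simp add: power_mult_distrib)
        \<comment> \<open>By the choice of \<open>w\<close>, the mixed term of \<open>s\<close> at
          \<open>f\<close> and \<open>w\<close> is exactly \<open>||w||^2\<close>.\<close>
        have "ip m w w = ip m (A f) w - complex_of_real a * ip m f w"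
          using ip_diff_left[OF L2_Omega_L2[OF A_in[OF f(1)]] L2_Omega_L2[OF L2_Omega_scale[OF f(1), of "complex_of_real a"]] L2_Omega_L2[OF w]]
          unfolding ip_scale_left by (simp add: w_def)
        then have Afw: "Re (ip m (A f) w) = Re (ip m w w) + a * Re (ip m f w)" by simp
        have "s (\<lambda>x. f x + complex_of_real t * w x) = s f + 2 * t * Re (ip m w w) + t\<^sup>2 * s w"
          unfolding s_def * quadratic_form_add_scale[OF f(1) w] Afw by (simp add: algebra_simps)
        then show "0 \<le> s f + 2 * t * Re (ip m w w) + t\<^sup>2 * s w"
          using s_nonneg[OF L2_Omega_add[OF f(1) tw]] by simp
      qed
      also have "\<dots> \<le> s f * ((M + \<bar>a\<bar>) * (l2norm m w)\<^sup>2)"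
      proof (rule mult_left_mono[OF _ s_nonneg[OF f(1)]])
        have "- (a * (l2norm m w)\<^sup>2) \<le> \<bar>a\<bar> * (l2norm m w)\<^sup>2"
          using mult_right_mono[of "- a" "\<bar>a\<bar>" "(l2norm m w)\<^sup>2"] by simp
        then show "s w \<le> (M + \<bar>a\<bar>) * (l2norm m w)\<^sup>2"
          unfolding s_def using quadratic_form_le[OF w] by (simp add: algebra_simps)
      qed
      finally have "(l2norm m w)\<^sup>2 * (l2norm m w)\<^sup>2 \<le> (s f * (M + \<bar>a\<bar>)) * (l2norm m w)\<^sup>2"
        by (simp add: l2norm_square[symmetric] power2_eq_square mult.assoc)
      \<comment> \<open>Here \<open>B w = f\<close> is a unit vector.\<close>
      moreover have "1 \<le> C * l2norm m w"
        using bspec[OF C w] bspec[OF B f(1)] f(2) by (simp add: w_def)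
      then have one: "1 \<le> C\<^sup>2 * (l2norm m w)\<^sup>2"
        using one_le_power[of "C * l2norm m w" 2] by (simp add: power_mult_distrib)
      then have "(l2norm m w)\<^sup>2 > 0" by (cases "l2norm m w = 0") auto
      ultimately have "(l2norm m w)\<^sup>2 \<le> s f * (M + \<bar>a\<bar>)" by (simp only: mult_le_cancel_right_pos)
      then have "C\<^sup>2 * (l2norm m w)\<^sup>2 \<le> C\<^sup>2 * (s f * (M + \<bar>a\<bar>))" by (rule mult_left_mono) simp
      then show ?thesis using one f(2) by (simp add: N_def s_def mult_ac)
    qed
    obtain e' where e': "e' \<in> ?V" "l2norm m e' = 1" using normalize[OF e] by blast
    \<comment> \<open>The sign of \<open>C^2 (M + |a|)\<close> is not known beforehand;
      \<open>gap\<close> at a single unit vector, where the form of \<open>A - a\<close> is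
      nonnegative, settles it. Then \<open>gap\<close> lifts the whole numerical range to
      \<open>a + 1 / N\<close>, above its own infimum.\<close>
    have N_pos: "N > 0"
    proof (rule ccontr)
      assume "\<not> N > 0"
      then have "N * (Re (ip m (A e') e') - a) \<le> 0"
        using below[OF e'(1)] e'(2) by (intro mult_nonpos_nonneg) auto
      then show False using gap[OF e'] by simp
    qed
    have "a + 1 / N \<le> Inf R"
    proof (rule cInf_greatest[OF R_ne])
      fix r assume "r \<in> R"
      then obtain f where "f \<in> ?V" "l2norm m f = 1" "r = Re (ip m (A f) f)" unfolding R_def by blast
      then show "a + 1 / N \<le> r" using gap[of f] N_pos by (simp add: field_simps)
    qed
    then show False using N_pos by (simp add: a_def)
  qed
  then show "complex_of_real (Inf R) \<in> spectrum_on m ?V A" by (simp add: a_def)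
qed

text \<open>The infimum of the numerical range is itself a point of the real spectrum, so it
  dominates the infimum of that spectrum; the latter is a true lower bound since points far to the
  left are excluded.\<close>

lemma Inf_spectrum_le_quadratic_form:
  assumes f: "f \<in> L2_Omega m D"
  shows "Inf {t. complex_of_real t \<in> spectrum_on m (L2_Omega m D) A} * (l2norm m f)\<^sup>2 \<le> Re (ip m (A f) f)"
proof (cases "l2norm m f = 0")
  case True
  then show ?thesis using quadratic_form_le[OF f] by simp
next
  case False
  let ?S = "{t. complex_of_real t \<in> spectrum_on m (L2_Omega m D) A}"
  let ?R = "{Re (ip m (A f) f) | f. f \<in> L2_Omega m D \<and> l2norm m f = 1}"
  have "bdd_below ?S"
  proof (rule bdd_belowI)
    fix t assume "t \<in> ?S"
    then show "- (2 * \<bar>M\<bar> + 1) \<le> t"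
      using far_negative_not_in_spectrum[of t] by fastforce
  qed
  then have "Inf ?S \<le> Inf ?R"
    using numerical_range_Inf_in_spectrum(1)[OF f False] by (intro cInf_lower) auto
  then have "Inf ?S * (l2norm m f)\<^sup>2 \<le> Inf ?R * (l2norm m f)\<^sup>2"
    by (rule mult_right_mono) simp
  also have "\<dots> \<le> Re (ip m (A f) f)"
    by (rule numerical_range_Inf_in_spectrum(2)[OF f False f])
  finally show ?thesis .
qed

end

section \<open>The graph Laplacian\<close>

lemma infsum_prod_swap: "(\<Sum>\<^sub>\<infinity>(x,y). F y x) = (\<Sum>\<^sub>\<infinity>(x,y). F x y)"
  by (rule infsum_reindex_bij_witness[of _ prod.swap prod.swap]) auto

lemma summable_on_prod_swap:
  assumes "(\<lambda>(x,y). F x y) summable_on UNIV"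
  shows "(\<lambda>(x,y). F y x) summable_on UNIV"
  using assms summable_on_swap[of "\<lambda>(x,y). F x y" UNIV UNIV] by simp

lemma row_summable:
  fixes F :: "'a \<Rightarrow> 'b \<Rightarrow> 'c::banach"
  assumes "(\<lambda>(x,y). F x y) summable_on UNIV"
  shows "F x summable_on UNIV"
proof -
  have "(\<lambda>(x,y). F x y) summable_on Pair x ` UNIV"
    using assms by (rule summable_on_subset_banach) simp
  then show ?thesis
    by (simp add: summable_on_reindex inj_on_def o_def)
qed

text \<open>\<open>C\<close> is a fixed bound from condition (B), cleared of the denominator
  \<open>m x\<close>.\<close>

locale bounded_graph =
  fixes b :: "'x \<Rightarrow> 'x \<Rightarrow> real" and m :: "'x \<Rightarrow> real" and C :: real
  assumes graph: "weighted_graph b m"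
    and deg_le: "(\<Sum>\<^sub>\<infinity>y. b x y) \<le> C * m x"

sublocale bounded_graph \<subseteq> weighted_l2 m
  using graph by unfold_locales (simp add: weighted_graph_def)

context bounded_graph
begin

lemma b_nonneg: "0 \<le> b x y" and b_sym: "b x y = b y x" and b_summable: "b x summable_on UNIV"
  using graph unfolding weighted_graph_def by auto

lemma deg_nonneg: "0 \<le> (\<Sum>\<^sub>\<infinity>y. b x y)"
  by (simp add: infsum_nonneg b_nonneg)

lemma C_nonneg: "0 \<le> C"
  using order_trans[OF deg_nonneg deg_le] m_pos by (meson zero_le_mult_iff not_less)

text \<open>Tonelli: summing over \<open>y\<close> first produces the degree of \<open>x\<close>,
  which is at most \<open>C * m x\<close>.\<close>

lemma
  assumes u: "\<And>x. 0 \<le> u x" "(\<lambda>x. u x * m x) summable_on UNIV"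
  shows pair_summable: "(\<lambda>(x,y). b x y * u x) summable_on UNIV"
    and pair_infsum_le: "(\<Sum>\<^sub>\<infinity>(x,y). b x y * u x) \<le> C * (\<Sum>\<^sub>\<infinity>x. u x * m x)"
proof -
  have deg_u_le: "(\<Sum>\<^sub>\<infinity>y. b x y) * u x \<le> C * (u x * m x)" for x
    using mult_right_mono[OF deg_le u(1)] by (simp add: mult_ac)
  have Cu: "(\<lambda>x. C * (u x * m x)) summable_on UNIV"
    by (rule summable_on_cmult_right[OF u(2)])
  have deg_u: "(\<lambda>x. (\<Sum>\<^sub>\<infinity>y. b x y) * u x) summable_on UNIV"
    by (rule summable_on_comparison_test[OF Cu]) (simp_all add: deg_u_le deg_nonneg u(1))
  have "(\<lambda>(x,y). b x y * u x) summable_on UNIV \<times> UNIV"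
  proof (rule summable_on_SigmaI[OF _ deg_u])
    show "((\<lambda>y. case (x, y) of (x, y) \<Rightarrow> b x y * u x) has_sum (\<Sum>\<^sub>\<infinity>y. b x y) * u x) UNIV" for x
      using has_sum_cmult_left[OF has_sum_infsum[OF b_summable]] by simp
  qed (simp add: b_nonneg u(1))
  then show *: "(\<lambda>(x,y). b x y * u x) summable_on UNIV" by simp
  have "(\<Sum>\<^sub>\<infinity>(x,y). b x y * u x) = (\<Sum>\<^sub>\<infinity>x. \<Sum>\<^sub>\<infinity>y. b x y * u x)"
    using infsum_Sigma'_banach[of "\<lambda>x y. b x y * u x" UNIV "\<lambda>_. UNIV"] * by simp
  also have "\<dots> = (\<Sum>\<^sub>\<infinity>x. (\<Sum>\<^sub>\<infinity>y. b x y) * u x)"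
    by (simp add: infsum_cmult_left')
  also have "\<dots> \<le> (\<Sum>\<^sub>\<infinity>x. C * (u x * m x))"
    by (rule infsum_mono[OF deg_u Cu deg_u_le])
  finally show "(\<Sum>\<^sub>\<infinity>(x,y). b x y * u x) \<le> C * (\<Sum>\<^sub>\<infinity>x. u x * m x)"
    by (simp add: infsum_cmult_right')
qed

text \<open>Bound \<open>|f x - f y|^2\<close> by \<open>2 |f x|^2 + 2 |f y|^2\<close>. By symmetry
  of \<open>b\<close> both halves have the same sum, at most \<open>2 C ||f||^2\<close> each. The
  sum runs over ordered pairs and is thus twice the quadratic form.\<close>

lemma
  assumes f: "f \<in> L2 m"
  shows gradient_summable: "(\<lambda>(x,y). b x y * (cmod (f x - f y))\<^sup>2) summable_on UNIV"
    and gradient_infsum_le: "(\<Sum>\<^sub>\<infinity>(x,y). b x y * (cmod (f x - f y))\<^sup>2) \<le> 4 * C * (l2norm m f)\<^sup>2"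
proof -
  let ?u = "\<lambda>x. 2 * (cmod (f x))\<^sup>2"
  let ?F = "\<lambda>x y. b x y * ?u x"
  have um: "(\<lambda>x. ?u x * m x) summable_on UNIV"
    using f summable_on_cmult_right[of "\<lambda>x. (cmod (f x))\<^sup>2 * m x" UNIV 2] by (simp add: L2_def mult.assoc)
  have F: "(\<lambda>(x,y). ?F x y) summable_on UNIV" by (rule pair_summable[OF _ um]) simp
  have F': "(\<lambda>(x,y). ?F y x) summable_on UNIV" by (rule summable_on_prod_swap[OF F])
  have sum: "(\<lambda>p. (case p of (x,y) \<Rightarrow> ?F x y) + (case p of (x,y) \<Rightarrow> ?F y x)) summable_on UNIV"
    by (rule summable_on_add[OF F F'])
  have le: "(case p of (x,y) \<Rightarrow> b x y * (cmod (f x - f y))\<^sup>2)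
      \<le> (case p of (x,y) \<Rightarrow> ?F x y) + (case p of (x,y) \<Rightarrow> ?F y x)" for p
  proof (cases p)
    case (Pair x y)
    have "(cmod (f x - f y))\<^sup>2 \<le> (cmod (f x) + cmod (f y))\<^sup>2"
      by (simp add: norm_triangle_ineq4 power_mono)
    also have "\<dots> \<le> ?u x + ?u y"
      using sum_squares_bound[of "cmod (f x)" "cmod (f y)"] by (simp add: power2_sum)
    finally have "b x y * (cmod (f x - f y))\<^sup>2 \<le> b x y * (?u x + ?u y)"
      using b_nonneg by (rule mult_left_mono)
    then show ?thesis using b_sym[of y x] Pair by (simp add: distrib_left)
  qed
  show grad: "(\<lambda>(x,y). b x y * (cmod (f x - f y))\<^sup>2) summable_on UNIV"
    by (rule summable_on_comparison_test[OF sum le]) (auto simp: b_nonneg)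
  have "(\<Sum>\<^sub>\<infinity>(x,y). b x y * (cmod (f x - f y))\<^sup>2)
      \<le> (\<Sum>\<^sub>\<infinity>p. (case p of (x,y) \<Rightarrow> ?F x y) + (case p of (x,y) \<Rightarrow> ?F y x))"
    by (rule infsum_mono[OF grad sum le])
  also have "\<dots> = 2 * (\<Sum>\<^sub>\<infinity>(x,y). ?F x y)"
    using infsum_add[OF F F'] infsum_prod_swap[of ?F] by simp
  also have "\<dots> \<le> 2 * (C * (\<Sum>\<^sub>\<infinity>x. ?u x * m x))"
    using pair_infsum_le[OF _ um] by simp
  also have "\<dots> = 4 * C * (l2norm m f)\<^sup>2"
    by (simp add: l2norm_square_infsum mult.assoc infsum_cmult_right')
  finally show "(\<Sum>\<^sub>\<infinity>(x,y). b x y * (cmod (f x - f y))\<^sup>2) \<le> 4 * C * (l2norm m f)\<^sup>2" .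
qed

text \<open>The inequality \<open>t <= 1 + t^2\<close> reduces the first power to the weights and
  the gradient, both summable along a row.\<close>

lemma row_abs_summable:
  assumes "f \<in> L2 m"
  shows "(\<lambda>y. b x y * cmod (f x - f y)) summable_on UNIV"
proof (rule summable_on_comparison_test)
  show "(\<lambda>y. b x y + b x y * (cmod (f x - f y))\<^sup>2) summable_on UNIV"
    by (intro summable_on_add b_summable row_summable[OF gradient_summable[OF assms]])
  fix y
  have "cmod (f x - f y) \<le> 1 + (cmod (f x - f y))\<^sup>2"
    using sum_squares_bound[of 1 "cmod (f x - f y)"] norm_ge_zero[of "f x - f y"]
    by (simp del: norm_ge_zero)
  then have "b x y * cmod (f x - f y) \<le> b x y * (1 + (cmod (f x - f y))\<^sup>2)"
    using b_nonneg by (rule mult_left_mono)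
  then show "b x y * cmod (f x - f y) \<le> b x y + b x y * (cmod (f x - f y))\<^sup>2"
    by (simp add: distrib_left)
qed (simp add: b_nonneg)

section \<open>The Laplacian as a bounded operator\<close>

lemma Hop_row_summable:
  assumes "f \<in> L2 m"
  shows "(\<lambda>y. complex_of_real (b x y) * (f x - f y)) summable_on UNIV"
proof (rule abs_summable_summable)
  show "(\<lambda>y. norm (complex_of_real (b x y) * (f x - f y))) summable_on UNIV"
    using row_abs_summable[OF assms, of x] by (simp add: norm_mult b_nonneg)
qed

lemma Hop_add:
  assumes "f \<in> L2 m" "g \<in> L2 m"
  shows "Hop b m (\<lambda>x. f x + g x) = (\<lambda>x. Hop b m f x + Hop b m g x)"
proof
  fix x
  have "(\<Sum>\<^sub>\<infinity>y. complex_of_real (b x y) * (f x + g x - (f y + g y)))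
      = (\<Sum>\<^sub>\<infinity>y. complex_of_real (b x y) * (f x - f y)) + (\<Sum>\<^sub>\<infinity>y. complex_of_real (b x y) * (g x - g y))"
    using infsum_add[OF Hop_row_summable[OF assms(1)] Hop_row_summable[OF assms(2)], of x x]
    by (simp add: algebra_simps)
  then show "Hop b m (\<lambda>x. f x + g x) x = Hop b m f x + Hop b m g x"
    unfolding Hop_def by (simp only: distrib_left)
qed

lemma Hop_scale: "Hop b m (\<lambda>x. c * f x) = (\<lambda>x. c * Hop b m f x)"
proof
  fix x
  have "(\<Sum>\<^sub>\<infinity>y. complex_of_real (b x y) * (c * f x - c * f y))
      = (\<Sum>\<^sub>\<infinity>y. c * (complex_of_real (b x y) * (f x - f y)))"
    by (simp add: algebra_simps)
  then show "Hop b m (\<lambda>x. c * f x) x = c * Hop b m f x"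
    unfolding Hop_def by (simp add: infsum_cmult_right' mult_ac)
qed

lemma Hop_diff:
  assumes "f \<in> L2 m" "g \<in> L2 m"
  shows "Hop b m (\<lambda>x. f x - g x) = (\<lambda>x. Hop b m f x - Hop b m g x)"
  using Hop_add[OF assms(1) L2_scale[OF assms(2), of "-1"]] Hop_scale[of "-1" g] by simp

text \<open>Cauchy-Schwarz with the weights \<open>b x y\<close> in \<open>y\<close> gives the
  gradient at \<open>x\<close> times the degree of \<open>x\<close>. The degree is at most
  \<open>C * m x\<close>, whose mass factor cancels the remaining \<open>1 / m x\<close>.\<close>

lemma Hop_point_le:
  assumes f: "f \<in> L2 m"
  shows "(cmod (Hop b m f x))\<^sup>2 * m x \<le> C * (\<Sum>\<^sub>\<infinity>y. b x y * (cmod (f x - f y))\<^sup>2)"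
proof -
  let ?v = "\<lambda>y. cmod (f x - f y)"
  let ?P = "\<Sum>\<^sub>\<infinity>y. b x y * ?v y" and ?G = "\<Sum>\<^sub>\<infinity>y. b x y * (?v y)\<^sup>2" and ?d = "\<Sum>\<^sub>\<infinity>y. b x y"
  have P: "(\<lambda>y. b x y * ?v y) summable_on UNIV" by (rule row_abs_summable[OF f])
  have G: "(\<lambda>y. b x y * (?v y)\<^sup>2) summable_on UNIV" by (rule row_summable[OF gradient_summable[OF f]])
  have G_nonneg: "0 \<le> ?G" by (simp add: infsum_nonneg b_nonneg)
  have CS: "?P\<^sup>2 \<le> ?G * ?d"
  proof (rule quadratic_nonneg_discriminant)
    fix t
    have "((\<lambda>y. b x y * (?v y)\<^sup>2 + (2 * t * (b x y * ?v y) + t\<^sup>2 * b x y))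
        has_sum (?G + (2 * t * ?P + t\<^sup>2 * ?d))) UNIV"
      by (intro has_sum_add has_sum_cmult_right has_sum_infsum P G b_summable)
    moreover have "0 \<le> b x y * (?v y)\<^sup>2 + (2 * t * (b x y * ?v y) + t\<^sup>2 * b x y)" for y
    proof -
      have "b x y * (?v y)\<^sup>2 + (2 * t * (b x y * ?v y) + t\<^sup>2 * b x y) = b x y * (?v y + t)\<^sup>2"
        by (simp add: power2_sum algebra_simps)
      then show ?thesis by (simp add: b_nonneg)
    qed
    ultimately have "0 \<le> ?G + (2 * t * ?P + t\<^sup>2 * ?d)"
      by (rule has_sum_nonneg)
    then show "0 \<le> ?G + 2 * t * ?P + t\<^sup>2 * ?d" by simp
  qed
  have "cmod (\<Sum>\<^sub>\<infinity>y. complex_of_real (b x y) * (f x - f y)) \<le> ?P"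
    using norm_infsum_bound[of "\<lambda>y. complex_of_real (b x y) * (f x - f y)" UNIV] P
    by (simp add: norm_mult b_nonneg)
  then have "(cmod (\<Sum>\<^sub>\<infinity>y. complex_of_real (b x y) * (f x - f y)))\<^sup>2 \<le> ?P\<^sup>2"
    by (simp add: power_mono)
  also have "\<dots> \<le> ?G * (C * m x)"
    using CS mult_left_mono[OF deg_le[of x] G_nonneg] by linarith
  finally have *: "(cmod (\<Sum>\<^sub>\<infinity>y. complex_of_real (b x y) * (f x - f y)))\<^sup>2 \<le> ?G * (C * m x)" .
  have "(cmod (Hop b m f x))\<^sup>2 * m x = (cmod (\<Sum>\<^sub>\<infinity>y. complex_of_real (b x y) * (f x - f y)))\<^sup>2 / m x"
    using m_pos[of x]
    by (simp add: Hop_def norm_mult norm_divide power_mult_distrib power_divide power2_eq_square)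
  also have "\<dots> \<le> ?G * (C * m x) / m x"
    using * m_pos[of x] by (intro divide_right_mono) auto
  finally show ?thesis using m_pos[of x] by (simp add: mult.commute)
qed

text \<open>Summing \<open>Hop_point_le\<close> over \<open>x\<close> leaves \<open>C\<close> times
  the full gradient sum, hence \<open>4 C^2 ||f||^2\<close>.\<close>

lemma
  assumes f: "f \<in> L2 m"
  shows Hop_L2: "Hop b m f \<in> L2 m"
    and Hop_norm_le: "l2norm m (Hop b m f) \<le> 2 * C * l2norm m f"
proof -
  let ?G = "\<lambda>x. \<Sum>\<^sub>\<infinity>y. b x y * (cmod (f x - f y))\<^sup>2"
  have grad: "(\<lambda>(x,y). b x y * (cmod (f x - f y))\<^sup>2) summable_on UNIV \<times> UNIV"
    using gradient_summable[OF f] by simp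
  have G: "(\<lambda>x. C * ?G x) summable_on UNIV"
    using summable_on_Sigma_banach[OF grad] by (rule summable_on_cmult_right)
  have "(\<lambda>x. (cmod (Hop b m f x))\<^sup>2 * m x) summable_on UNIV"
    by (rule summable_on_comparison_test[OF G Hop_point_le[OF f]]) (simp add: m_pos less_imp_le)
  then show "Hop b m f \<in> L2 m" by (simp add: L2_def)
  have "(l2norm m (Hop b m f))\<^sup>2 \<le> (\<Sum>\<^sub>\<infinity>x. C * ?G x)"
    unfolding l2norm_square_infsum
    by (rule infsum_mono[OF _ G Hop_point_le[OF f]]) fact
  also have "\<dots> = C * (\<Sum>\<^sub>\<infinity>(x,y). b x y * (cmod (f x - f y))\<^sup>2)"
    using infsum_Sigma'_banach[OF grad] by (simp add: infsum_cmult_right')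
  also have "\<dots> \<le> C * (4 * C * (l2norm m f)\<^sup>2)"
    using gradient_infsum_le[OF f] C_nonneg by (rule mult_left_mono)
  also have "\<dots> = (2 * C * l2norm m f)\<^sup>2" by (simp add: power2_eq_square)
  finally show "l2norm m (Hop b m f) \<le> 2 * C * l2norm m f"
    by (rule power2_le_imp_le) (simp add: C_nonneg l2norm_nonneg)
qed

text \<open>Expand \<open>cnj (g x - g y)\<close>: by symmetry of \<open>b\<close> the second part
  is \<open>F\<close> with its arguments exchanged, so the two parts have equal sums and absorb the
  factor 1/2. Absolute summability of \<open>F\<close>, from the gradient of \<open>f\<close> and
  the weighted mass of \<open>g\<close>, justifies splitting and iterating the double sum.\<close>

lemma green_formula:
  assumes f: "f \<in> L2 m" and g: "g \<in> L2 m"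
  shows "qform b f g = ip m (Hop b m f) g"
proof -
  define F where "F x y = complex_of_real (b x y) * (f x - f y) * cnj (g x)" for x y
  have gm: "(\<lambda>x. (cmod (g x))\<^sup>2 * m x) summable_on UNIV" using g by (simp add: L2_def)
  have "(\<lambda>p. (case p of (x,y) \<Rightarrow> b x y * (cmod (f x - f y))\<^sup>2) + (case p of (x,y) \<Rightarrow> b x y * (cmod (g x))\<^sup>2))
      summable_on UNIV"
    by (intro summable_on_add gradient_summable[OF f] pair_summable gm) simp
  then have "(\<lambda>p. norm (case p of (x,y) \<Rightarrow> F x y)) summable_on UNIV"
  proof (rule Infinite_Sum.abs_summable_on_comparison_test')
    fix p :: "'x \<times> 'x"
    obtain x y where p: "p = (x, y)" by fastforce
    have "cmod (f x - f y) * cmod (g x) \<le> (cmod (f x - f y))\<^sup>2 + (cmod (g x))\<^sup>2"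
      using sum_squares_bound[of "cmod (f x - f y)" "cmod (g x)"]
        mult_nonneg_nonneg[of "cmod (f x - f y)" "cmod (g x)"] by (auto simp del: mult_nonneg_nonneg)
    then have "b x y * (cmod (f x - f y) * cmod (g x)) \<le> b x y * ((cmod (f x - f y))\<^sup>2 + (cmod (g x))\<^sup>2)"
      using b_nonneg by (rule mult_left_mono)
    then show "norm (case p of (x,y) \<Rightarrow> F x y)
        \<le> (case p of (x,y) \<Rightarrow> b x y * (cmod (f x - f y))\<^sup>2) + (case p of (x,y) \<Rightarrow> b x y * (cmod (g x))\<^sup>2)"
      by (simp add: p F_def norm_mult b_nonneg distrib_left mult.assoc)
  qed
  then have F: "(\<lambda>(x,y). F x y) summable_on UNIV" by (rule abs_summable_summable)
  have "(\<lambda>(x,y). complex_of_real (b x y) * (f x - f y) * cnj (g x - g y))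
      = (\<lambda>p. (case p of (x,y) \<Rightarrow> F x y) + (case p of (x,y) \<Rightarrow> F y x))"
    by (auto simp: F_def b_sym algebra_simps)
  then have "qform b f g = (1/2) * ((\<Sum>\<^sub>\<infinity>(x,y). F x y) + (\<Sum>\<^sub>\<infinity>(x,y). F y x))"
    unfolding qform_def using infsum_add[OF F summable_on_prod_swap[OF F]] by simp
  also have "\<dots> = (\<Sum>\<^sub>\<infinity>(x,y). F x y)"
    by (simp add: infsum_prod_swap[of F])
  also have "\<dots> = (\<Sum>\<^sub>\<infinity>x. \<Sum>\<^sub>\<infinity>y. F x y)"
    using infsum_Sigma'_banach[of F UNIV "\<lambda>_. UNIV"] F by simp
  also have "\<dots> = ip m (Hop b m f) g"
    unfolding ip_def F_def Hop_def using m_pos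
    by (intro infsum_cong) (simp add: infsum_cmult_left' less_imp_neq[symmetric])
  finally show ?thesis .
qed

section \<open>Symmetry and positivity of the Laplacian\<close>

lemma qform_commute: "qform b g f = cnj (qform b f g)"
proof -
  have "cnj (\<Sum>\<^sub>\<infinity>(x,y). complex_of_real (b x y) * (f x - f y) * cnj (g x - g y))
      = (\<Sum>\<^sub>\<infinity>(x,y). complex_of_real (b x y) * (g x - g y) * cnj (f x - f y))"
    by (subst infsum_cnj[symmetric], intro infsum_cong) (auto simp: mult_ac)
  then show ?thesis unfolding qform_def by simp
qed

lemma Hop_symmetric:
  assumes "f \<in> L2 m" "g \<in> L2 m"
  shows "ip m (Hop b m f) g = ip m f (Hop b m g)"
  unfolding green_formula[OF assms, symmetric] ip_commute[of f "Hop b m g"]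
    green_formula[OF assms(2,1), symmetric] by (rule qform_commute)

lemma Hop_nonneg:
  assumes "f \<in> L2 m"
  shows "0 \<le> Re (ip m (Hop b m f) f)"
proof -
  have "((\<lambda>p. complex_of_real (case p of (x,y) \<Rightarrow> b x y * (cmod (f x - f y))\<^sup>2))
      has_sum complex_of_real (\<Sum>\<^sub>\<infinity>(x,y). b x y * (cmod (f x - f y))\<^sup>2)) UNIV"
    by (intro has_sum_of_real has_sum_infsum gradient_summable assms)
  moreover have "(\<lambda>p. complex_of_real (case p of (x,y) \<Rightarrow> b x y * (cmod (f x - f y))\<^sup>2))
      = (\<lambda>(x,y). complex_of_real (b x y) * (f x - f y) * cnj (f x - f y))"
    by (simp only: case_prod_unfold of_real_mult complex_norm_square mult.assoc)
  ultimately have "ip m (Hop b m f) f = complex_of_real (1/2 * (\<Sum>\<^sub>\<infinity>(x,y). b x y * (cmod (f x - f y))\<^sup>2))"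
    unfolding green_formula[OF assms assms, symmetric] qform_def by (simp add: infsumI)
  then have "Re (ip m (Hop b m f) f) = 1/2 * (\<Sum>\<^sub>\<infinity>(x,y). b x y * (cmod (f x - f y))\<^sup>2)"
    by (simp only: Re_complex_of_real)
  moreover have "0 \<le> (\<Sum>\<^sub>\<infinity>(x,y). b x y * (cmod (f x - f y))\<^sup>2)"
    by (rule infsum_nonneg) (auto simp: b_nonneg)
  ultimately show ?thesis by simp
qed

text \<open>By the Green formula, the compression of \<open>Hop\<close> to the subspace represents
  the form. As \<open>assoc_op\<close> is a definite description, uniqueness is needed too: values
  off \<open>D\<close> are found by testing with point masses, which lie in the subspace there, and
  everything else is prescribed to be 0.\<close>

lemma H_Omega_eq:
  "H_Omega b m D = (\<lambda>f. if f \<in> L2_Omega m D then (\<lambda>x. if x \<in> D then 0 else Hop b m f x) else (\<lambda>x. 0))"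
  (is "_ = ?A")
  unfolding H_Omega_def assoc_op_def
proof (rule the_equality)
  let ?V = "L2_Omega m D"
  have A_in: "?A f \<in> ?V" if "f \<in> ?V" for f
    using L2_restrict[OF Hop_L2[OF L2_Omega_L2[OF that]]] that by simp
  have A_form: "qform b f g = ip m (?A f) g" if "f \<in> ?V" "g \<in> ?V" for f g
    using that green_formula[OF L2_Omega_L2 L2_Omega_L2] ip_restrict by simp
  show "(\<forall>f. f \<notin> ?V \<longrightarrow> ?A f = (\<lambda>_. 0)) \<and> (\<forall>f\<in>?V. ?A f \<in> ?V) \<and> (\<forall>f\<in>?V. \<forall>g\<in>?V. qform b f g = ip m (?A f) g)"
    using A_in A_form by simp
  fix A assume A: "(\<forall>f. f \<notin> ?V \<longrightarrow> A f = (\<lambda>_. 0)) \<and> (\<forall>f\<in>?V. A f \<in> ?V) \<and> (\<forall>f\<in>?V. \<forall>g\<in>?V. qform b f g = ip m (A f) g)"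
  have "A f x = ?A f x" if f: "f \<in> ?V" for f x
  proof (cases "x \<in> D")
    case True
    then show ?thesis using A A_in[OF f] f unfolding L2_Omega_def by auto
  next
    case False
    then have d: "(\<lambda>y. if y = x then 1 else 0) \<in> ?V" using L2_delta[of x] by (auto simp: L2_Omega_def)
    have "ip m (A f) (\<lambda>y. if y = x then 1 else 0) = ip m (?A f) (\<lambda>y. if y = x then 1 else 0)"
      unfolding A_form[OF f d, symmetric] using A f d by simp
    then show ?thesis unfolding ip_delta using m_pos[of x] by simp
  qed
  moreover have "A f x = ?A f x" if "f \<notin> ?V" for f x using A that by simp
  ultimately have "A f x = ?A f x" for f x by (cases "f \<in> ?V") (simp_all only: simp_thms)
  then show "A = ?A" by (intro ext)
qed

text \<open>\<open>H_Omega\<close> inherits linearity, symmetry and the bound \<open>2 * C\<close>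
  from \<open>Hop\<close>, and the cut-off disappears in its quadratic form.\<close>

lemma lambda_Omega_le:
  assumes f: "f \<in> L2_Omega m D"
  shows "lambda_Omega b m D * (l2norm m f)\<^sup>2 \<le> Re (ip m (Hop b m f) f)"
proof -
  let ?V = "L2_Omega m D"
  have A: "H_Omega b m D f = (\<lambda>x. if x \<in> D then 0 else Hop b m f x)" if "f \<in> ?V" for f
    using that by (simp add: H_Omega_eq)
  interpret op: bounded_symmetric_op m D "H_Omega b m D" "2 * C"
  proof
    fix f g c assume f: "f \<in> ?V"
    show "H_Omega b m D f \<in> ?V" unfolding A[OF f] by (intro L2_restrict Hop_L2 L2_Omega_L2[OF f])
    show "H_Omega b m D (\<lambda>x. c * f x) = (\<lambda>x. c * H_Omega b m D f x)"
      unfolding A[OF f] A[OF L2_Omega_scale[OF f]] Hop_scale by auto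
    have "l2norm m (H_Omega b m D f) \<le> l2norm m (Hop b m f)"
      unfolding A[OF f] by (rule l2norm_mono[OF Hop_L2[OF L2_Omega_L2[OF f]]]) simp
    then show "l2norm m (H_Omega b m D f) \<le> 2 * C * l2norm m f"
      using Hop_norm_le[OF L2_Omega_L2[OF f]] by linarith
    assume g: "g \<in> ?V"
    show "H_Omega b m D (\<lambda>x. f x + g x) = (\<lambda>x. H_Omega b m D f x + H_Omega b m D g x)"
      unfolding A[OF f] A[OF g] A[OF L2_Omega_add[OF f g]] Hop_add[OF L2_Omega_L2[OF f] L2_Omega_L2[OF g]]
      by auto
    show "ip m (H_Omega b m D f) g = ip m f (H_Omega b m D g)"
      unfolding A[OF f] A[OF g] ip_restrict[OF g] ip_commute[of f] ip_restrict[OF f]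
      using Hop_symmetric[OF L2_Omega_L2[OF f] L2_Omega_L2[OF g]] ip_commute[of f "Hop b m g"] by simp
  qed
  show ?thesis
    using op.Inf_spectrum_le_quadratic_form[OF f]
    unfolding lambda_Omega_def A[OF f] ip_restrict[OF f] .
qed

text \<open>\<open>opnorm\<close> is a supremum over the unit ball, so it is informative only after
  the bound \<open>2 * C + 1\<close> is established; the estimate then follows by rescaling to norm
  one.\<close>

lemma Hop_plus_one_norm_le:
  assumes f: "f \<in> L2 m"
  shows "l2norm m (\<lambda>x. Hop b m f x + f x) \<le> opnorm m (\<lambda>f x. Hop b m f x + f x) * l2norm m f"
proof (cases "l2norm m f = 0")
  case True
  then have "l2norm m (\<lambda>x. Hop b m f x + f x) = 0"
    using l2norm_triangle[OF Hop_L2[OF f] f] Hop_norm_le[OF f] True l2norm_nonneg[of "\<lambda>x. Hop b m f x + f x"]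
    by simp
  then show ?thesis using True by simp
next
  case False
  define c where "c = complex_of_real (1 / l2norm m f)"
  have pos: "l2norm m f > 0" using False l2norm_nonneg[of f] by simp
  have norm_c: "cmod c = 1 / l2norm m f" using pos by (simp add: c_def norm_divide)
  let ?X = "{l2norm m (\<lambda>x. Hop b m f x + f x) | f. f \<in> L2 m \<and> l2norm m f \<le> 1}"
  have "bdd_above ?X"
  proof (rule bdd_aboveI)
    fix r assume "r \<in> ?X"
    then obtain h where h: "h \<in> L2 m" "l2norm m h \<le> 1" "r = l2norm m (\<lambda>x. Hop b m h x + h x)" by blast
    have "2 * C * l2norm m h \<le> 2 * C * 1" using h(2) C_nonneg by (intro mult_left_mono) auto
    then show "r \<le> 2 * C + 1"
      using l2norm_triangle[OF Hop_L2[OF h(1)] h(1)] Hop_norm_le[OF h(1)] h by linarith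
  qed
  moreover have "l2norm m (\<lambda>x. Hop b m (\<lambda>x. c * f x) x + c * f x) \<in> ?X"
    using L2_scale[OF f, of c] pos by (intro CollectI exI[of _ "\<lambda>x. c * f x"]) (simp add: l2norm_scale norm_c)
  ultimately have "l2norm m (\<lambda>x. Hop b m (\<lambda>x. c * f x) x + c * f x) \<le> opnorm m (\<lambda>f x. Hop b m f x + f x)"
    unfolding opnorm_def by (intro cSup_upper)
  moreover have "l2norm m (\<lambda>x. Hop b m (\<lambda>x. c * f x) x + c * f x) = l2norm m (\<lambda>x. Hop b m f x + f x) / l2norm m f"
    using l2norm_scale[of c "\<lambda>x. Hop b m f x + f x"]
    by (simp add: Hop_scale distrib_left norm_c)
  ultimately show ?thesis using pos by (simp add: pos_divide_le_eq)
qed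

text \<open>In the expansion of \<open>||H f + f||^2\<close> the mixed term is nonnegative by
  positivity of \<open>H\<close>, so either square may be dropped.\<close>

lemma Hop_le_Hop_plus_one:
  assumes f: "f \<in> L2 m"
  shows "l2norm m (Hop b m f) \<le> l2norm m (\<lambda>x. Hop b m f x + f x)"
    and "l2norm m f \<le> l2norm m (\<lambda>x. Hop b m f x + f x)"
proof -
  have "(l2norm m (Hop b m f))\<^sup>2 \<le> (l2norm m (\<lambda>x. Hop b m f x + f x))\<^sup>2"
    "(l2norm m f)\<^sup>2 \<le> (l2norm m (\<lambda>x. Hop b m f x + f x))\<^sup>2"
    using Hop_nonneg[OF f] by (simp_all add: l2norm_add_square[OF Hop_L2[OF f] f])
  then show "l2norm m (Hop b m f) \<le> l2norm m (\<lambda>x. Hop b m f x + f x)"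
    "l2norm m f \<le> l2norm m (\<lambda>x. Hop b m f x + f x)"
    using l2norm_nonneg power2_le_imp_le by blast+
qed

text \<open>The spectral projection enters only through the energy bound on \<open>g\<close>: a
  function whose energy lies below \<open>lambda_Omega\<close> cannot concentrate off
  \<open>D\<close>.\<close>

lemma unique_continuation:
  assumes g: "g \<in> L2 m" and energy: "Re (ip m (Hop b m g) g) \<le> \<mu> * (l2norm m g)\<^sup>2"
    and less: "\<mu> < lambda_Omega b m D"
  shows "(lambda_Omega b m D - \<mu>)\<^sup>2
      / (16 * (opnorm m (\<lambda>f x. Hop b m f x + f x))\<^sup>2 * (lambda_Omega b m D + 1)\<^sup>2) * (l2norm m g)\<^sup>2
    \<le> (l2norm m (\<lambda>x. if x \<in> D then g x else 0))\<^sup>2"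
proof (cases "l2norm m g = 0")
  case True
  then show ?thesis by simp
next
  case False
  define lam where "lam = lambda_Omega b m D"
  define N where "N = opnorm m (\<lambda>f x. Hop b m f x + f x)"
  define h where "h = (\<lambda>x. if x \<in> D then 0 else g x)"
  define k where "k = (\<lambda>x. if x \<in> D then g x else 0)"
  have g_pos: "l2norm m g > 0" using False l2norm_nonneg[of g] by simp
  \<comment> \<open>Positivity of the form makes \<open>\<mu>\<close> nonnegative and hence
    \<open>lam\<close> positive, which fixes the signs in all later estimates.\<close>
  have "0 \<le> \<mu> * (l2norm m g)\<^sup>2" using Hop_nonneg[OF g] energy by linarith
  then have mu: "0 \<le> \<mu>" using g_pos by (simp add: zero_le_mult_iff)
  then have lam: "0 < lam" using less by (simp add: lam_def)
  have H_le: "l2norm m (Hop b m f) \<le> N * l2norm m f" and one_le: "l2norm m f \<le> N * l2norm m f"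
    if "f \<in> L2 m" for f
    using Hop_le_Hop_plus_one[OF that] Hop_plus_one_norm_le[OF that] unfolding N_def by linarith+
  have N: "1 \<le> N" using one_le[OF g] g_pos by simp
  have hV: "h \<in> L2_Omega m D" unfolding h_def by (rule L2_restrict[OF g])
  note h = L2_Omega_L2[OF hV]
  have k: "k \<in> L2 m" unfolding k_def by (rule L2_mono[OF g]) simp
  have k_le: "l2norm m k \<le> l2norm m g" unfolding k_def by (rule l2norm_mono[OF g]) simp
  have g_eq: "g = (\<lambda>x. h x + k x)" and h_eq: "h = (\<lambda>x. g x - k x)" by (auto simp: h_def k_def)
  have "ip m h k = 0"
    unfolding ip_def by (rule infsum_0) (simp add: h_def k_def)
  then have pyth: "(l2norm m g)\<^sup>2 = (l2norm m h)\<^sup>2 + (l2norm m k)\<^sup>2"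
    using l2norm_add_square[OF h k] by (simp flip: g_eq)
  have cross: "Re (ip m (Hop b m k) g) = Re (ip m (Hop b m g) k)"
    using Hop_symmetric[OF k g] ip_commute[of k "Hop b m g"] by simp
  have "ip m (Hop b m h) h = ip m (Hop b m g) g - ip m (Hop b m g) k - ip m (Hop b m k) g + ip m (Hop b m k) k"
    unfolding h_eq Hop_diff[OF g k]
    by (simp add: ip_diff_left ip_diff_right Hop_L2 L2_diff g k)
  then have expand: "Re (ip m (Hop b m h) h)
      = Re (ip m (Hop b m g) g) - 2 * Re (ip m (Hop b m g) k) + Re (ip m (Hop b m k) k)"
    using cross by simp
  have cross_le: "\<bar>Re (ip m (Hop b m g) k)\<bar> \<le> N * l2norm m g * l2norm m k"
    using Re_ip_le[OF Hop_L2[OF g] k] mult_right_mono[OF H_le[OF g] l2norm_nonneg[of k]] by linarith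
  have "\<bar>Re (ip m (Hop b m k) k)\<bar> \<le> N * l2norm m k * l2norm m k"
    using Re_ip_le[OF Hop_L2[OF k] k] mult_right_mono[OF H_le[OF k] l2norm_nonneg[of k]] by linarith
  also have "\<dots> \<le> N * l2norm m g * l2norm m k"
    using k_le N l2norm_nonneg[of k] by (intro mult_right_mono mult_left_mono) auto
  finally have diag_le: "Re (ip m (Hop b m k) k) \<le> N * l2norm m g * l2norm m k" by linarith
  \<comment> \<open>The factor 3 counts the cross term twice and the diagonal term of
    \<open>k\<close> once.\<close>
  have "lam * (l2norm m h)\<^sup>2 \<le> \<mu> * (l2norm m g)\<^sup>2 + 3 * (N * l2norm m g * l2norm m k)"
    using lambda_Omega_le[OF hV] expand energy cross_le diag_le unfolding lam_def by linarith
  then have "(lam - \<mu>) * (l2norm m g)\<^sup>2 \<le> 3 * (N * l2norm m g * l2norm m k) + lam * (l2norm m k)\<^sup>2"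
    using pyth by (simp add: algebra_simps)
  \<comment> \<open>Since \<open>||k|| <= ||g||\<close> and \<open>1 <= N\<close>, the Pythagorean
    remainder too becomes a multiple of \<open>N ||g|| ||k||\<close>.\<close>
  also have "lam * (l2norm m k)\<^sup>2 \<le> lam * (N * l2norm m g * l2norm m k)"
  proof -
    have "1 * l2norm m k \<le> N * l2norm m g"
      using N k_le l2norm_nonneg[of k] by (intro mult_mono) auto
    then have "l2norm m k * l2norm m k \<le> N * l2norm m g * l2norm m k"
      using l2norm_nonneg[of k] by (simp add: mult_right_mono)
    then show ?thesis using lam by (simp add: power2_eq_square)
  qed
  \<comment> \<open>The generous bound \<open>3 + lam <= 4 (lam + 1)\<close> is what yields the
    constant 16 after squaring.\<close>
  also have "3 * (N * l2norm m g * l2norm m k) + lam * (N * l2norm m g * l2norm m k)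
      \<le> (4 * N * (lam + 1) * l2norm m k) * l2norm m g"
  proof -
    have "(3 + lam) * (N * l2norm m g * l2norm m k) \<le> (4 * (lam + 1)) * (N * l2norm m g * l2norm m k)"
      using lam N l2norm_nonneg[of k] g_pos by (intro mult_right_mono) auto
    then show ?thesis by (simp add: algebra_simps)
  qed
  finally have "(lam - \<mu>) * l2norm m g \<le> 4 * N * (lam + 1) * l2norm m k"
    using g_pos by (simp add: power2_eq_square mult.assoc[symmetric])
  then have "((lam - \<mu>) * l2norm m g)\<^sup>2 \<le> (4 * N * (lam + 1) * l2norm m k)\<^sup>2"
    using less g_pos by (intro power_mono) (simp_all add: lam_def)
  then have "(lam - \<mu>)\<^sup>2 * (l2norm m g)\<^sup>2 \<le> (l2norm m k)\<^sup>2 * (16 * N\<^sup>2 * (lam + 1)\<^sup>2)"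
    unfolding power_mult_distrib by (simp add: mult_ac)
  moreover have "16 * N\<^sup>2 * (lam + 1)\<^sup>2 > 0" using N lam by simp
  ultimately have "(lam - \<mu>)\<^sup>2 / (16 * N\<^sup>2 * (lam + 1)\<^sup>2) * (l2norm m g)\<^sup>2 \<le> (l2norm m k)\<^sup>2"
    by (simp add: pos_divide_le_eq del: zero_less_mult_iff)
  then show ?thesis by (simp add: lam_def N_def k_def)
qed

end

section \<open>Spectral subspaces\<close>

text \<open>The spectral measure of \<open>E I f\<close> is carried by \<open>I\<close>, where
  \<open>t <= c\<close>. Integrating \<open>t\<close> gives at most \<open>c\<close> times the total
  mass, which is the squared norm of \<open>E I f\<close>.\<close>

lemma spectral_subspace_energy_le:
  assumes E: "is_spectral_measure m A E" and I: "I \<in> sets borel" "\<forall>t\<in>I. t \<le> c" and f: "f \<in> L2 m"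
  shows "Re (ip m (A (E I f)) (E I f)) \<le> c * Re (ip m (E I f) (E I f))"
proof -
  have E_in: "\<And>S f. S \<in> sets borel \<Longrightarrow> f \<in> L2 m \<Longrightarrow> E S f \<in> L2 m"
    and E_sym: "\<And>S f g. S \<in> sets borel \<Longrightarrow> f \<in> L2 m \<Longrightarrow> g \<in> L2 m \<Longrightarrow> ip m (E S f) g = ip m f (E S g)"
    and E_Int: "\<And>S T f. S \<in> sets borel \<Longrightarrow> T \<in> sets borel \<Longrightarrow> f \<in> L2 m \<Longrightarrow> E (S \<inter> T) f = E S (E T f)"
    and E_UNIV: "\<And>f. f \<in> L2 m \<Longrightarrow> E UNIV f = f"
    and E_meas: "\<And>f. f \<in> L2 m \<Longrightarrow> \<exists>\<mu>. finite_measure \<mu> \<and> sets \<mu> = sets (borel :: real measure) \<and>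
        (\<forall>S\<in>sets (borel :: real measure). measure \<mu> S = Re (ip m (E S f) f)) \<and>
        integrable \<mu> (\<lambda>t. t) \<and> ip m (A f) f = complex_of_real (\<integral>t. t \<partial>\<mu>)"
    using E unfolding is_spectral_measure_def by auto
  let ?g = "E I f"
  have g: "?g \<in> L2 m" by (rule E_in[OF I(1) f])
  obtain \<mu> where \<mu>: "finite_measure \<mu>" "sets \<mu> = sets (borel :: real measure)"
      "\<And>S. S \<in> sets borel \<Longrightarrow> measure \<mu> S = Re (ip m (E S ?g) ?g)"
      "integrable \<mu> (\<lambda>t. t)" "ip m (A ?g) ?g = complex_of_real (\<integral>t. t \<partial>\<mu>)"
    using E_meas[OF g] by blast
  interpret finite_measure \<mu> by fact
  have cI: "- I \<in> sets borel" using I(1) by (simp add: sets.compl_sets[of I borel, simplified] Compl_eq_Diff_UNIV)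
  \<comment> \<open>That \<open>E {}\<close> has zero quadratic form is not an axiom; it follows
    because this form is the measure of the empty set.\<close>
  obtain \<nu> where "\<forall>S\<in>sets (borel :: real measure). measure \<nu> S = Re (ip m (E S f) f)"
    using E_meas[OF f] by blast
  then have E_empty: "Re (ip m (E {} f) f) = 0"
    by (metis measure_empty sets.empty_sets)
  have "measure \<mu> (- I) = Re (ip m (E {} f) ?g)"
    using \<mu>(3)[OF cI] E_Int[OF cI I(1) f] by simp
  \<comment> \<open>Moving \<open>E I\<close> to the left factor is harmless, since
    \<open>E I (E {} f) = E {} f\<close> by multiplicativity.\<close>
  also have "ip m (E {} f) ?g = ip m (E {} f) f"
    using E_sym[OF I(1) E_in[OF _ f] f, of "{}"] E_Int[OF I(1) _ f, of "{}"] by simp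
  finally have "measure \<mu> (- I) = 0" using E_empty by simp
  then have "- I \<in> null_sets \<mu>"
    using cI \<mu>(2) by (auto simp: null_sets_def emeasure_eq_measure)
  then have "AE t in \<mu>. t \<in> I"
    by (auto dest: AE_not_in)
  then have "AE t in \<mu>. t \<le> c" using I(2) by auto
  then have "(\<integral>t. t \<partial>\<mu>) \<le> (\<integral>t. c \<partial>\<mu>)"
    using \<mu>(4) by (intro integral_mono_AE) auto
  also have "\<dots> = c * measure \<mu> UNIV"
    using sets_eq_imp_space_eq[OF \<mu>(2)] by simp
  also have "measure \<mu> UNIV = Re (ip m ?g ?g)"
    using \<mu>(3)[of UNIV] E_UNIV[OF g] by simp
  finally show ?thesis using \<mu>(5) by simp
qed

theorem theorem5p1:
  fixes b :: "'x::countable \<Rightarrow> 'x \<Rightarrow> real" and m :: "'x \<Rightarrow> real"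
    and D :: "'x set" and I :: "real set" and imax :: real
    and E :: "real set \<Rightarrow> ('x \<Rightarrow> complex) \<Rightarrow> ('x \<Rightarrow> complex)"
  assumes "weighted_graph b m" and "cond_B b m" and "cond_M m"
    and "connected_graph b" and "rel_dense b D" and "- D \<noteq> {}"
    and "I \<in> sets (borel :: real measure)" and "imax \<in> I" and "\<forall>t\<in>I. t \<le> imax"
    and "imax < lambda_Omega b m D"
    and "is_spectral_measure m (Hop b m) E"
  shows "\<forall>f\<in>L2 m.
     Re (ip m (E I (\<lambda>x. if x \<in> D then E I f x else 0)) f) \<ge>
       (lambda_Omega b m D - imax)\<^sup>2 /
         (16 * (opnorm m (\<lambda>f x. Hop b m f x + f x))\<^sup>2 * (lambda_Omega b m D + 1)\<^sup>2)
       * Re (ip m (E I f) f)"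
proof
  fix f assume f: "f \<in> L2 m"
  obtain C where C: "\<And>x. (\<Sum>\<^sub>\<infinity>y. b x y) / m x \<le> C"
    using assms(2) by (auto simp: cond_B_def)
  have "m x > 0" for x using assms(1) by (simp add: weighted_graph_def)
  then interpret bounded_graph b m C
    using assms(1) C by unfold_locales (simp_all add: pos_divide_le_eq)
  have E_in: "\<And>f. f \<in> L2 m \<Longrightarrow> E I f \<in> L2 m"
    and E_sym: "\<And>f g. f \<in> L2 m \<Longrightarrow> g \<in> L2 m \<Longrightarrow> ip m (E I f) g = ip m f (E I g)"
    and E_idem: "\<And>f. f \<in> L2 m \<Longrightarrow> E I (E I f) = E I f"
    using assms(7,11) unfolding is_spectral_measure_def by (blast, blast, metis Int_absorb)
  let ?g = "E I f" and ?k = "\<lambda>x. if x \<in> D then E I f x else 0"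
  have g: "?g \<in> L2 m" by (rule E_in[OF f])
  have k: "?k \<in> L2 m" by (rule L2_mono[OF g]) simp
  \<comment> \<open>Symmetry and idempotence of \<open>E I\<close> turn both sides of the claim into
    squared norms: \<open>?k\<close> for the left, \<open>?g\<close> for the right.\<close>
  have "ip m (E I ?k) f = ip m ?k ?k"
  proof -
    have "ip m ?k ?g = ip m ?k ?k" unfolding ip_def by (rule infsum_cong) simp
    then show ?thesis by (simp only: E_sym[OF k f])
  qed
  moreover have "ip m ?g f = ip m ?g ?g"
    using E_sym[OF g f] E_idem[OF f] by simp
  moreover have "Re (ip m (Hop b m ?g) ?g) \<le> imax * (l2norm m ?g)\<^sup>2"
    using spectral_subspace_energy_le[OF assms(11,7,9) f] by (simp add: l2norm_square)
  ultimately show "Re (ip m (E I ?k) f) \<ge>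
       (lambda_Omega b m D - imax)\<^sup>2 /
         (16 * (opnorm m (\<lambda>f x. Hop b m f x + f x))\<^sup>2 * (lambda_Omega b m D + 1)\<^sup>2)
       * Re (ip m ?g f)"
    using unique_continuation[OF g _ assms(10)] by (simp add: l2norm_square)
qed

end
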